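(* Let $X_{n,i}$, $n\in\mathbb N$, $i\in\mathbb Z^d$, be a triangular array of random fields with values in a measurable space $S$. For $n\in\mathbb N$, let $\mathcal K_n\subset\mathbb Z^d$ be finite, and for $k\in\mathcal K_n$ let $\mathbf Z_{n,k}=f_{n,k}(X_{n,k+i},\ i\in\mathcal I_0)$, where $\mathcal I_0=\{i\in\mathbb Z^d:|i|\le1\}$ and $f_{n,k}:S^{\mathcal I_0}\to\mathbb R^p$ is measurable. Let $\mathbf S_n=\sum_{k\in\mathcal K_n}\mathbf Z_{n,k}$. Assume: (i) $c_3:=\sup_{n\in\mathbb N}\sup_{k\in\mathcal K_n}\mathbf E|\mathbf Z_{n,k}|^3<\infty$; (ii) for all $n\in\mathbb N$ and $k\in\mathcal K_n$, $\mathbf E(\mathbf Z_{n,k}\mid X_{n,j},\ j\neq k)=0$; (iii) $|\mathcal K_n|\to+\infty$ as $n\to\infty$; (iv) there exists a symmetric positive-semidefinite matrix $\Sigma$ such that $$\mathbf E\Big\||\mathcal K_n|^{-1}\sum_{k\in\mathcal K_n}\ \sum_{j\in\mathcal K_n,\ |j-k|\le1}\mathbf Z_{n,k}\mathbf Z_{n,j}^T-\Sigma\Big\|\to0.$$ Then $|\mathcal K_n|^{-1/2}\mathbf S_n\stackrel{d}{\longrightarrow}\mathcal N(0,\Sigma)$ as $n\to\infty$.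
   Context: $|\cdot|$ denotes the uniform norm of a vector of $\mathbb R^p$ or $\mathbb Z^d$, and the cardinality of a finite set; $\|\cdot\|$ is the Frobenius norm of a matrix. *)

theory Defs
  imports "HOL-Probability.Probability"
begin

section \<open>Vectors and matrices\<close>

text \<open>Uniform norm on the lattice \<open>\<int>\<^sup>d\<close>. On \<open>\<real>\<^sup>p\<close> the uniform norm is the library's \<^const>\<open>infnorm\<close>.\<close>

definition unorm :: "int ^ 'd \<Rightarrow> int" where
  "unorm i = Max (range (\<lambda>l. \<bar>i $ l\<bar>))"

definition I0 :: "(int ^ 'd) set" where
  "I0 = {i. unorm i \<le> 1}"

definition outer :: "real ^ 'p \<Rightarrow> real ^ 'p \<Rightarrow> real ^ 'p ^ 'p" where
  "outer v w = (\<chi> a b. v $ a * w $ b)"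

lemma outer_eq_matrix_product:
  "outer v w = (columnvector v :: real ^ 1 ^ 'p) ** transpose (columnvector w)"
  by (simp add: vec_eq_iff outer_def matrix_matrix_mult_def columnvector_def transpose_def)

text \<open>The library's norm on \<^typ>\<open>real ^ 'p ^ 'q\<close> is the Frobenius norm.\<close>

lemma norm_eq_frobenius:
  fixes A :: "real ^ 'p ^ 'q"
  shows "norm A = sqrt (\<Sum>a\<in>UNIV. \<Sum>b\<in>UNIV. (A $ a $ b)\<^sup>2)"
  by (simp add: norm_vec_def L2_set_def sum_nonneg)

definition psd_matrix :: "real ^ 'p ^ 'p \<Rightarrow> bool" where
  "psd_matrix A \<longleftrightarrow> transpose A = A \<and> (\<forall>v. 0 \<le> v \<bullet> (A *v v))"


section \<open>Conditional expectation of random vectors\<close>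

text \<open>The \<open>\<sigma>\<close>-algebra on the sample space generated by the variables \<open>X j\<close>, \<open>j \<in> J\<close>.\<close>

definition sigma_gen_vars ::
    "'w measure \<Rightarrow> 's measure \<Rightarrow> 'i set \<Rightarrow> ('i \<Rightarrow> 'w \<Rightarrow> 's) \<Rightarrow> 'w measure" where
  "sigma_gen_vars M S J X =
     sigma (space M) {X j -` A \<inter> space M | j A. j \<in> J \<and> A \<in> sets S}"

lemma subalgebra_sigma_gen_vars:
  assumes "\<And>j. j \<in> J \<Longrightarrow> X j \<in> M \<rightarrow>\<^sub>M S"
  shows "subalgebra M (sigma_gen_vars M S J X)"
proof -
  let ?G = "{X j -` A \<inter> space M | j A. j \<in> J \<and> A \<in> sets S}"
  have "?G \<subseteq> sets M"
    using assms by (auto intro: measurable_sets)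
  then have "sigma_sets (space M) ?G \<subseteq> sets M" "?G \<subseteq> Pow (space M)"
    by (auto intro!: sets.sigma_sets_subset)
  then show ?thesis
    by (simp add: subalgebra_def sigma_gen_vars_def sets_measure_of space_measure_of)
qed

definition vec_cond_exp ::
    "'w measure \<Rightarrow> 'w measure \<Rightarrow> ('w \<Rightarrow> real ^ 'p) \<Rightarrow> 'w \<Rightarrow> real ^ 'p" where
  "vec_cond_exp M F Y \<omega> = (\<chi> l. real_cond_exp M F (\<lambda>\<omega>. Y \<omega> $ l) \<omega>)"


section \<open>Weak convergence and the multivariate normal distribution\<close>

definition weak_conv_measure ::
    "(nat \<Rightarrow> 'a::topological_space measure) \<Rightarrow> 'a measure \<Rightarrow> bool" where
  "weak_conv_measure P Q \<longleftrightarrow>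
     (\<forall>g :: 'a \<Rightarrow> real. continuous_on UNIV g \<longrightarrow> bounded (range g) \<longrightarrow>
        (\<lambda>n. \<integral>x. g x \<partial>P n) \<longlonglongrightarrow> (\<integral>x. g x \<partial>Q))"

text \<open>
  \<open>N(m, V)\<close> is the law of \<open>m + A \<zeta>\<close> with \<open>\<zeta>\<close> a vector of independent standard normal
  variables and \<open>A A\<^sup>T = V\<close>; \<open>V\<close> may be singular. The lemmas below show that for positive
  semidefinite \<open>V\<close> such an \<open>A\<close> exists, and that the characteristic function, hence the law,
  does not depend on which one is chosen.
\<close>

definition mv_normal :: "real ^ 'p \<Rightarrow> real ^ 'p ^ 'p \<Rightarrow> (real ^ 'p) measure" where
  "mv_normal m V =
     (let A = (SOME A :: real ^ 'p ^ 'p. A ** transpose A = V) in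
      distr (\<Pi>\<^sub>M a\<in>UNIV. std_normal_distribution) borel (\<lambda>z. m + A *v (\<chi> a. z a)))"

lemma psd_matrix_diag_nonneg:
  assumes "psd_matrix A" shows "0 \<le> A $ a $ a"
proof -
  have "axis a 1 \<bullet> (A *v axis a 1) = A $ a $ a"
    by (simp add: matrix_vector_mult_basis column_def inner_axis')
  then show ?thesis using assms unfolding psd_matrix_def by metis
qed

lemma psd_matrix_shift:
  fixes V :: "real ^ 'p ^ 'p"
  assumes "psd_matrix V"
  shows "0 \<le> v \<bullet> (V *v v) + 2 * t * (column a V \<bullet> v) + t\<^sup>2 * V $ a $ a"
proof -
  have sym: "transpose V = V" using assms by (simp add: psd_matrix_def)
  have Va: "V *v axis a 1 = column a V" by (simp add: matrix_vector_mult_basis)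
  have e: "axis a 1 \<bullet> (V *v v) = column a V \<bullet> v"
    by (metis Va sym dot_lmul_matrix transpose_matrix_vector)
  have f: "axis a 1 \<bullet> column a V = V $ a $ a"
    by (simp add: column_def inner_axis')
  have "0 \<le> (v + t *\<^sub>R axis a 1) \<bullet> (V *v (v + t *\<^sub>R axis a 1))"
    using assms by (simp add: psd_matrix_def)
  also have "\<dots> = v \<bullet> (V *v v) + 2 * t * (column a V \<bullet> v) + t\<^sup>2 * V $ a $ a"
    by (simp add: matrix_vector_right_distrib matrix_vector_mult_scaleR Va inner_add_left
        inner_add_right e f inner_commute[of v "column a V"] algebra_simps power2_eq_square)
  finally show ?thesis .
qed

lemma psd_matrix_zero_column:
  fixes V :: "real ^ 'p ^ 'p"
  assumes "psd_matrix V" "V $ a $ a = 0"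
  shows "V $ b $ a = 0"
proof (rule ccontr)
  assume n: "V $ b $ a \<noteq> 0"
  have c: "column a V \<bullet> axis b 1 = V $ b $ a"
    by (simp add: column_def inner_axis)
  define q where "q = axis b 1 \<bullet> (V *v axis b 1)"
  have "0 \<le> q + 2 * t * V $ b $ a" for t
    using psd_matrix_shift[OF assms(1), of "axis b 1" t a] assms(2) c by (simp add: q_def)
  from this[of "- (q + 1) / (2 * V $ b $ a)"] n show False
    by (simp add: field_simps)
qed

lemma psd_matrix_factor_aux:
  fixes V :: "real ^ 'p ^ 'p"
  assumes "finite I" "psd_matrix V" "\<And>a b. a \<notin> I \<Longrightarrow> V $ a $ b = 0"
  shows "\<exists>A :: real ^ 'p ^ 'p. A ** transpose A = V \<and> (\<forall>a b. b \<notin> I \<longrightarrow> A $ a $ b = 0)"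
  using assms
proof (induction I arbitrary: V rule: finite_induct)
  case empty
  have "(0 :: real ^ 'p ^ 'p) ** transpose 0 = V"
    using empty by (simp add: vec_eq_iff matrix_matrix_mult_def)
  then show ?case by (intro exI[of _ 0]) simp
next
  case (insert c J)
  have sym: "V $ a $ b = V $ b $ a" for a b
    using insert.prems(1) unfolding psd_matrix_def transpose_def by (metis vec_lambda_beta)
  show ?case
  proof (cases "V $ c $ c = 0")
    case True
    have "V $ a $ b = 0" if "a \<notin> J" for a b
      using that insert.prems(2)[of a b] psd_matrix_zero_column[OF insert.prems(1) True, of b] sym
      by (cases "a = c") auto
    from insert.IH[OF insert.prems(1) this] show ?thesis by auto
  next
    case False
    define r where "r = V $ c $ c"
    have r: "r > 0"
      using psd_matrix_diag_nonneg[OF insert.prems(1), of c] False by (simp add: r_def)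
    define W :: "real ^ 'p ^ 'p" where "W = (\<chi> a b. V $ a $ b - V $ a $ c * V $ b $ c / r)"
    have q: "v \<bullet> (W *v v) = v \<bullet> (V *v v) - (column c V \<bullet> v)\<^sup>2 / r" for v
    proof -
      have "W *v v = V *v v - ((column c V \<bullet> v) / r) *\<^sub>R column c V"
        by (simp add: vec_eq_iff W_def matrix_vector_mult_def column_def inner_vec_def
            algebra_simps sum_subtractf sum_distrib_left sum_divide_distrib)
      then show ?thesis
        by (simp add: inner_diff_right power2_eq_square inner_commute[of v "column c V"])
    qed
    have "psd_matrix W"
      unfolding psd_matrix_def
    proof (intro conjI allI)
      show "transpose W = W"
        by (simp add: vec_eq_iff transpose_def W_def sym mult.commute)
      fix v
      show "0 \<le> v \<bullet> (W *v v)"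
        using psd_matrix_shift[OF insert.prems(1), of v "- (column c V \<bullet> v) / r" c] r
        by (simp add: q r_def[symmetric] power2_eq_square field_simps)
    qed
    moreover have "W $ a $ b = 0" if "a \<notin> J" for a b
      using that insert.prems(2)[of a] r sym[of b c]
      by (cases "a = c") (auto simp: W_def r_def)
    ultimately obtain B :: "real ^ 'p ^ 'p" where B: "B ** transpose B = W"
      and B0: "\<And>a b. b \<notin> J \<Longrightarrow> B $ a $ b = 0"
      using insert.IH by blast
    define A :: "real ^ 'p ^ 'p"
      where "A = (\<chi> a b. if b = c then V $ a $ c / sqrt r else B $ a $ b)"
    have "(A ** transpose A) $ a $ b = V $ a $ b" for a b
    proof -
      have "(A ** transpose A) $ a $ b = (\<Sum>k\<in>UNIV. A $ a $ k * A $ b $ k)"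
        by (simp add: matrix_matrix_mult_def transpose_def)
      also have "\<dots> = A $ a $ c * A $ b $ c + (\<Sum>k\<in>UNIV - {c}. A $ a $ k * A $ b $ k)"
        by (simp add: sum.remove)
      also have "(\<Sum>k\<in>UNIV - {c}. A $ a $ k * A $ b $ k) = (\<Sum>k\<in>UNIV - {c}. B $ a $ k * B $ b $ k)"
        by (intro sum.cong) (auto simp: A_def)
      also have "\<dots> = (\<Sum>k\<in>UNIV. B $ a $ k * B $ b $ k)"
        using B0[of c] insert.hyps by (simp add: sum.remove[of UNIV c])
      also have "\<dots> = W $ a $ b"
        by (simp add: B[symmetric] matrix_matrix_mult_def transpose_def)
      finally show ?thesis using r by (simp add: A_def W_def)
    qed
    moreover have "A $ a $ b = 0" if "b \<notin> insert c J" for a b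
      using that B0 by (simp add: A_def)
    ultimately show ?thesis by (intro exI[of _ A]) (simp add: vec_eq_iff)
  qed
qed

lemma psd_matrix_factor:
  fixes V :: "real ^ 'p ^ 'p"
  assumes "psd_matrix V"
  shows "\<exists>A :: real ^ 'p ^ 'p. A ** transpose A = V"
  using psd_matrix_factor_aux[of UNIV V] assms by auto

lemma char_affine_std_normal:
  fixes A :: "real ^ 'p ^ 'p"
  shows "(CLINT x | distr (\<Pi>\<^sub>M a\<in>UNIV. std_normal_distribution) borel (\<lambda>z. m + A *v (\<chi> a. z a)).
            iexp (t \<bullet> x)) = iexp (t \<bullet> m) * of_real (exp (- (t \<bullet> ((A ** transpose A) *v t)) / 2))"
proof -
  let ?N = "\<Pi>\<^sub>M a\<in>(UNIV :: 'p set). std_normal_distribution"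
  interpret std: prob_space std_normal_distribution
    using real_dist_normal_dist by (simp add: real_distribution_def)
  interpret P: product_sigma_finite "\<lambda>_ :: 'p. std_normal_distribution"
    by (simp add: product_sigma_finite_def std.sigma_finite_measure_axioms)
  define s where "s = transpose A *v t"
  have lin: "t \<bullet> (A *v v) = s \<bullet> v" for v
    unfolding s_def by (metis dot_lmul_matrix transpose_matrix_vector)
  have m[measurable]: "(\<lambda>z. m + A *v (\<chi> a. z a)) \<in> ?N \<rightarrow>\<^sub>M borel"
  proof -
    have c: "(\<lambda>z :: 'p \<Rightarrow> real. z a) \<in> ?N \<rightarrow>\<^sub>M borel" for a
      using measurable_component_singleton[of a UNIV "\<lambda>_. std_normal_distribution"] by simp
    have "(\<lambda>z. m + (\<Sum>a\<in>UNIV. z a *\<^sub>R column a A)) \<in> ?N \<rightarrow>\<^sub>M borel"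
      using c by (intro borel_measurable_add borel_measurable_sum borel_measurable_scaleR) auto
    then show ?thesis
      by (simp add: matrix_mult_sum scalar_mult_eq_scaleR)
  qed
  have "(CLINT x | distr ?N borel (\<lambda>z. m + A *v (\<chi> a. z a)). iexp (t \<bullet> x))
      = (CLINT z | ?N. iexp (t \<bullet> (m + A *v (\<chi> a. z a))))"
    by (subst integral_distr) (auto intro!: borel_measurable_continuous_onI continuous_intros)
  also have "\<dots> = (CLINT z | ?N. iexp (t \<bullet> m) * (\<Prod>a\<in>UNIV. iexp (s $ a * z a)))"
  proof -
    have "iexp (t \<bullet> (m + A *v (\<chi> a. z a))) = iexp (t \<bullet> m) * (\<Prod>a\<in>UNIV. iexp (s $ a * z a))"
      for z :: "'p \<Rightarrow> real"
    proof -
      have "(\<Prod>a\<in>UNIV. iexp (s $ a * z a)) = iexp (\<Sum>a\<in>UNIV. s $ a * z a)"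
        by (simp add: exp_sum[symmetric] sum_distrib_left)
      also have "(\<Sum>a\<in>UNIV. s $ a * z a) = t \<bullet> (A *v (\<chi> a. z a))"
        unfolding lin by (simp add: inner_vec_def)
      finally show ?thesis
        by (simp add: inner_add_right exp_add[symmetric] distrib_left)
    qed
    then show ?thesis by simp
  qed
  also have "\<dots> = iexp (t \<bullet> m) * (\<Prod>a\<in>UNIV. char std_normal_distribution (s $ a))"
    unfolding char_def
    by (subst P.product_integral_prod[symmetric]) (auto intro!: std.integrable_iexp)
  also have "(\<Prod>a\<in>UNIV. char std_normal_distribution (s $ a)) = of_real (exp (- (s \<bullet> s) / 2))"
    by (simp add: char_std_normal_distribution inner_vec_def power2_eq_square exp_sum
        sum_negf[symmetric] sum_divide_distrib)
  also have "s \<bullet> s = t \<bullet> ((A ** transpose A) *v t)"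
    using lin[of s] by (simp only: s_def matrix_vector_mul_assoc)
  finally show ?thesis .
qed

lemma char_mv_normal:
  assumes "psd_matrix V"
  shows "(CLINT x | mv_normal m V. iexp (t \<bullet> x)) =
           iexp (t \<bullet> m) * of_real (exp (- (t \<bullet> (V *v t)) / 2))"
proof -
  have "(SOME A :: real ^ 'a ^ 'a. A ** transpose A = V)
      ** transpose (SOME A :: real ^ 'a ^ 'a. A ** transpose A = V) = V"
    using psd_matrix_factor[OF assms] by (rule someI_ex)
  then show ?thesis
    by (simp add: mv_normal_def Let_def char_affine_std_normal)
qed

end

theory Submission
  imports Defs
begin

text \<open>
  Fix \<open>t\<close>, put \<open>Y k = t \<bullet> Z k\<close>, let \<open>W\<close> be the normalised sum of the \<open>Y k\<close> and \<open>T k\<close> the same sum without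
  the neighbours of \<open>k\<close>. As \<open>T k\<close> does not involve \<open>X k\<close>, the centring hypothesis gives
  \<open>E (Y k exp (i s T k)) = 0\<close>. Hence in \<open>\<phi>' s = E (i W exp (i s W))\<close> one may replace each
  \<open>Y k exp (i s W)\<close> by \<open>Y k (exp (i s W) - exp (i s T k))\<close>; expanding the difference to first order yields
  \<open>\<phi>' s = - s E (V exp (i s W))\<close> up to \<open>O(\<bar>K\<bar>\<^sup>-\<^sup>1\<^sup>/\<^sup>2)\<close>, where \<open>V\<close> is the normalised sum of the \<open>Y k Y j\<close> over
  neighbours. Since \<open>V\<close> tends to \<open>\<sigma>\<^sup>2 = t \<bullet> \<Sigma> t\<close> in mean, the derivative of
  \<open>\<phi> s exp (s\<^sup>2 \<sigma>\<^sup>2 / 2)\<close> tends to \<open>0\<close> uniformly on \<open>[0, 1]\<close>, so \<open>\<phi> 1\<close> tends to \<open>exp (- \<sigma>\<^sup>2 / 2)\<close>.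

  Levy's continuity theorem is transferred from the line to Euclidean spaces: the one-dimensional theorem
  controls the tails of the marginals, and on a large box a continuous function is approximated by
  trigonometric polynomials.
\<close>

section \<open>Levy's continuity theorem in Euclidean spaces\<close>

text \<open>The functions whose integrals are finite combinations of values of the characteristic
  function. With monomials and sums as the only constructors, integrability and convergence of
  integrals are direct inductions; closure under products is derived below.\<close>

inductive trig_poly :: "('a::euclidean_space \<Rightarrow> complex) \<Rightarrow> bool" where
  monom: "trig_poly (\<lambda>x. c * iexp (t \<bullet> x))"
| add: "trig_poly u \<Longrightarrow> trig_poly v \<Longrightarrow> trig_poly (\<lambda>x. u x + v x)"

lemma trig_poly_const: "trig_poly (\<lambda>x. c)"
  using trig_poly.monom[of c 0] by simp

lemma trig_poly_sum:
  assumes "finite I" "\<And>i. i \<in> I \<Longrightarrow> trig_poly (u i)"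
  shows "trig_poly (\<lambda>x. \<Sum>i\<in>I. u i x)"
  using assms by (induction I rule: finite_induct) (auto intro: trig_poly_const trig_poly.add)

lemma trig_poly_monom_mult:
  assumes "trig_poly u"
  shows "trig_poly (\<lambda>x. (c * iexp (t \<bullet> x)) * u x)"
  using assms
proof induction
  case (monom d s)
  have "(\<lambda>x. (c * iexp (t \<bullet> x)) * (d * iexp (s \<bullet> x))) = (\<lambda>x. (c * d) * iexp ((t + s) \<bullet> x))"
    by (simp add: inner_add_left exp_add distrib_left mult_ac)
  then show ?case by (metis trig_poly.monom)
next
  case (add u v)
  then show ?case by (simp add: distrib_left trig_poly.add)
qed

lemma trig_poly_mult:
  assumes "trig_poly u" "trig_poly v"
  shows "trig_poly (\<lambda>x. u x * v x)"
  using assms(1)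
  by induction (simp_all add: assms(2) trig_poly_monom_mult distrib_right trig_poly.add)

lemma trig_poly_sin:
  "trig_poly (\<lambda>x. complex_of_real (sin (t \<bullet> x)))"
proof -
  have "complex_of_real (sin (t \<bullet> x))
      = (- \<i> / 2) * iexp (t \<bullet> x) + (\<i> / 2) * iexp ((- t) \<bullet> x)" for x
    by (simp add: sin_of_real[symmetric] sin_exp_eq field_simps)
  then show ?thesis
    by (simp only:) (intro trig_poly.intros)
qed

text \<open>A linear functional of the vector of sines is a combination of sines, hence
  trigonometric; constants, sums and products preserve the class. This carries Stone-Weierstrass
  approximation on a cube over to trigonometric polynomials.\<close>

lemma trig_poly_real_polynomial_function:
  assumes "real_polynomial_function p"
  shows "trig_poly (\<lambda>x :: 'a::euclidean_space.
    complex_of_real (p (\<Sum>b\<in>Basis. sin (x \<bullet> b / L) *\<^sub>R b :: 'a)))"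
  using assms
proof induction
  case (linear f)
  then interpret bounded_linear f .
  have "trig_poly (\<lambda>x. \<Sum>b\<in>Basis. complex_of_real (f b) * of_real (sin (((1 / L) *\<^sub>R b) \<bullet> x)))"
    by (intro trig_poly_sum trig_poly_mult trig_poly_const trig_poly_sin) simp
  then show ?case
    by (simp add: sum scaleR inner_commute mult.commute)
qed (simp_all add: trig_poly_const trig_poly.add trig_poly_mult)

lemma trig_poly_integrable:
  fixes M :: "'a::euclidean_space measure"
  assumes "prob_space M" "sets M = sets borel" "trig_poly u"
  shows "integrable M u"
  using assms(3)
proof induction
  interpret prob_space M by (rule assms(1))
  case (monom c t)
  have [measurable]: "(\<lambda>x. iexp (t \<bullet> x)) \<in> borel_measurable M"
    unfolding measurable_cong_sets[OF assms(2) refl]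
    by (intro borel_measurable_continuous_onI continuous_intros)
  show ?case
    by (intro integrable_mult_right integrable_const_bound[of _ 1]) auto
qed auto

lemma trig_poly_integral_tendsto:
  fixes P :: "nat \<Rightarrow> 'a::euclidean_space measure" and Q :: "'a measure"
  assumes "\<And>n. prob_space (P n)" "\<And>n. sets (P n) = sets borel"
    and "prob_space Q" "sets Q = sets borel"
    and char: "\<And>t. (\<lambda>n. CLINT x|P n. iexp (t \<bullet> x)) \<longlonglongrightarrow> (CLINT x|Q. iexp (t \<bullet> x))"
    and "trig_poly u"
  shows "(\<lambda>n. \<integral>x. u x \<partial>P n) \<longlonglongrightarrow> (\<integral>x. u x \<partial>Q)"
  using assms(6)
proof induction
  case (monom c t)
  show ?case unfolding integral_mult_right_zero by (intro tendsto_mult_left char)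
next
  case (add u v)
  show ?case
    using tendsto_add[OF add.IH] add.hyps
    by (simp add: trig_poly_integrable assms(1-4))
qed

text \<open>
  A polynomial approximation of \<open>s \<mapsto> g (L arcsin s)\<close> on the cube, read at \<open>s = sin (x / L)\<close>, is bounded on
  the whole space, while on the box \<open>\<bar>x \<bullet> b\<bar> \<le> \<pi> L / 2\<close> the arcsine undoes the sine.
\<close>

lemma real_polynomial_sin_approx:
  fixes g :: "'a::euclidean_space \<Rightarrow> real"
  assumes g: "continuous_on UNIV g" and B: "\<And>x. \<bar>g x\<bar> \<le> B" and "e > 0" "r > 0"
  obtains T where "trig_poly (\<lambda>x. complex_of_real (T x))"
    "\<And>x. (\<And>b. b \<in> Basis \<Longrightarrow> \<bar>x \<bullet> b\<bar> \<le> r) \<Longrightarrow> \<bar>T x - g x\<bar> < e"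
    "\<And>x. \<bar>T x - g x\<bar> < e + 2 * B"
proof -
  \<comment> \<open>With this scale \<open>r / L = pi / 2\<close>, so on the box of half-width
    \<open>r\<close> the arguments of the sine stay in the interval where \<open>arcsin\<close>
    inverts it.\<close>
  define L where "L = 2 * r / pi"
  have L: "L > 0" using \<open>r > 0\<close> by (simp add: L_def)
  define \<theta> :: "'a \<Rightarrow> 'a" where "\<theta> x = (\<Sum>b\<in>Basis. sin (x \<bullet> b / L) *\<^sub>R b)" for x
  define \<rho> :: "'a \<Rightarrow> 'a" where "\<rho> s = (\<Sum>b\<in>Basis. (L * arcsin (s \<bullet> b)) *\<^sub>R b)" for s
  have \<theta>: "\<theta> x \<in> cbox (- One) One" for x
    by (simp add: mem_box \<theta>_def)
  have "continuous_on (cbox (- One) One) \<rho>"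
    unfolding \<rho>_def by (intro continuous_intros) (auto simp: mem_box)
  then have "continuous_on (cbox (- One) One) (\<lambda>s. g (\<rho> s))"
    by (rule continuous_on_compose2[OF g]) auto
  from Stone_Weierstrass_real_polynomial_function[OF compact_cbox this \<open>e > 0\<close>]
  obtain p where p: "real_polynomial_function p"
    and ap: "\<And>s. s \<in> cbox (- One) One \<Longrightarrow> \<bar>g (\<rho> s) - p s\<bar> < e" by blast
  show ?thesis
  proof
    show "trig_poly (\<lambda>x. complex_of_real (p (\<theta> x)))"
      unfolding \<theta>_def by (rule trig_poly_real_polynomial_function[OF p])
    \<comment> \<open>Away from the box, \<open>p (\<theta> x)\<close> is still within
      \<open>e\<close> of \<open>g\<close> at another point, namely
      \<open>\<rho> (\<theta> x)\<close>, and two values of \<open>g\<close> differ by at most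
      \<open>2 * B\<close>.\<close>
    show "\<bar>p (\<theta> x) - g x\<bar> < e + 2 * B" for x
      using ap[OF \<theta>[of x]] B[of x] B[of "\<rho> (\<theta> x)"] by linarith
    show "\<bar>p (\<theta> x) - g x\<bar> < e" if x: "\<And>b. b \<in> Basis \<Longrightarrow> \<bar>x \<bullet> b\<bar> \<le> r" for x
    proof -
      have "L * arcsin (sin (x \<bullet> b / L)) = x \<bullet> b" if "b \<in> Basis" for b
      proof -
        have "\<bar>x \<bullet> b / L\<bar> \<le> r / L"
          using x[OF that] L by (simp add: abs_divide divide_right_mono)
        also have "r / L = pi / 2" using \<open>r > 0\<close> by (simp add: L_def)
        finally have "arcsin (sin (x \<bullet> b / L)) = x \<bullet> b / L"
          by (intro arcsin_sin) linarith+
        then show ?thesis using L by simp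
      qed
      then have "\<rho> (\<theta> x) = x"
        by (simp add: \<rho>_def \<theta>_def euclidean_eq_iff[where 'a='a])
      with ap[OF \<theta>[of x]] show ?thesis by (simp add: abs_minus_commute)
    qed
  qed
qed

section \<open>The continuity theorem for characteristic functions\<close>

text \<open>Integrals of trigonometric polynomials converge by linearity. A test function
  \<open>g\<close> is compared with such a polynomial \<open>T\<close> on a box; outside it the
  error is dominated by a continuous function of the single coordinates, whose integrals converge by
  the theorem on the line.\<close>

theorem levy_continuity_euclidean:
  fixes P :: "nat \<Rightarrow> 'a::euclidean_space measure" and Q :: "'a measure"
  assumes prob_P: "\<And>n. prob_space (P n)" and sets_P: "\<And>n. sets (P n) = sets borel"
    and prob_Q: "prob_space Q" and sets_Q: "sets Q = sets borel"
    and char: "\<And>t. (\<lambda>n. CLINT x|P n. iexp (t \<bullet> x)) \<longlonglongrightarrow> (CLINT x|Q. iexp (t \<bullet> x))"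
  shows "weak_conv_measure P Q"
  unfolding weak_conv_measure_def
proof (intro allI impI)
  fix g :: "'a \<Rightarrow> real"
  assume g: "continuous_on UNIV g" and bdd: "bounded (range g)"
  interpret P: prob_space "P n" for n by (rule prob_P)
  interpret Q: prob_space Q by (rule prob_Q)
  have meas_P: "f \<in> borel_measurable (P n) \<longleftrightarrow> f \<in> borel_measurable borel" for f :: "'a \<Rightarrow> real" and n
    by (simp add: measurable_cong_sets[OF sets_P refl])
  have meas_Q: "f \<in> borel_measurable Q \<longleftrightarrow> f \<in> borel_measurable borel" for f :: "'a \<Rightarrow> real"
    by (simp add: measurable_cong_sets[OF sets_Q refl])
  have int_P: "integrable (P n) f" if "continuous_on UNIV f" "\<And>x. \<bar>f x\<bar> \<le> c"
    for f :: "'a \<Rightarrow> real" and c n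
    using that
    by (intro P.integrable_const_bound[of _ c]) (auto simp: meas_P intro: borel_measurable_continuous_onI)
  have int_Q: "integrable Q f" if "continuous_on UNIV f" "\<And>x. \<bar>f x\<bar> \<le> c"
    for f :: "'a \<Rightarrow> real" and c
    using that
    by (intro Q.integrable_const_bound[of _ c]) (auto simp: meas_Q intro: borel_measurable_continuous_onI)
  obtain B where B: "B > 0" "\<And>x. \<bar>g x\<bar> \<le> B"
    using bdd unfolding bounded_pos by (auto simp: image_iff)
  \<comment> \<open>A continuous ramp, equal to \<open>0\<close> for arguments of modulus at most
    \<open>R\<close> and to \<open>1\<close> from \<open>R + 1\<close> on. Thus \<open>H R\<close>
    is at least \<open>1\<close> outside the box of half-width \<open>R + 1\<close>, which is why
    \<open>T\<close> below approximates \<open>g\<close> on that larger box.\<close>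
  define h where "h R y = min 1 (max 0 (\<bar>y\<bar> - R))" for R y :: real
  define H where "H R x = (\<Sum>b\<in>Basis. h R (x \<bullet> b))" for R and x :: 'a
  have h: "0 \<le> h R y" "h R y \<le> 1" "\<bar>h R y\<bar> \<le> 1" for R y by (auto simp: h_def)
  have cont_h: "continuous_on A (h R)" for A R
    unfolding h_def by (intro continuous_intros)
  have cont_hb: "continuous_on UNIV (\<lambda>x. h R (x \<bullet> b))" for R and b :: 'a
    by (rule continuous_on_compose2[OF cont_h[of UNIV]]) (auto intro!: continuous_intros)
  have cont_H: "continuous_on UNIV (H R)" for R
    unfolding H_def by (intro continuous_intros cont_hb)
  have H0: "0 \<le> H R x" for R x unfolding H_def by (intro sum_nonneg h)
  have HD: "\<bar>H R x\<bar> \<le> DIM('a)" for R x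
    using H0[of R x] sum_bounded_above[of Basis "\<lambda>b. h R (x \<bullet> b)" 1] h(2) by (simp add: H_def)
  have tail: "(\<lambda>n. \<integral>x. H R x \<partial>P n) \<longlonglongrightarrow> (\<integral>x. H R x \<partial>Q)" for R
  proof -
    have "(\<lambda>n. \<integral>x. h R (x \<bullet> b) \<partial>P n) \<longlonglongrightarrow> (\<integral>x. h R (x \<bullet> b) \<partial>Q)" for b
    proof -
      have m: "(\<lambda>x. x \<bullet> b) \<in> borel_measurable (P n)" "(\<lambda>x. x \<bullet> b) \<in> borel_measurable Q" for n
        by (simp_all add: meas_P meas_Q)
      have hm: "h R \<in> borel_measurable borel"
        by (rule borel_measurable_continuous_onI[OF cont_h])
      \<comment> \<open>The characteristic function of the law of \<open>x \<bullet> b\<close>, at a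
        real \<open>t\<close>, is the multivariate one at the vector
        \<open>t *\<^sub>R b\<close>.\<close>
      have "weak_conv_m (\<lambda>n. distr (P n) borel (\<lambda>x. x \<bullet> b)) (distr Q borel (\<lambda>x. x \<bullet> b))"
      proof (rule levy_continuity)
        show "(\<lambda>n. char (distr (P n) borel (\<lambda>x. x \<bullet> b)) t) \<longlonglongrightarrow> char (distr Q borel (\<lambda>x. x \<bullet> b)) t" for t
          using char[of "t *\<^sub>R b"] m unfolding char_def
          by (simp add: integral_distr inner_commute)
      qed (use m in auto)
      then have "(\<lambda>n. integral\<^sup>L (distr (P n) borel (\<lambda>x. x \<bullet> b)) (h R))
          \<longlonglongrightarrow> integral\<^sup>L (distr Q borel (\<lambda>x. x \<bullet> b)) (h R)"
        using m cont_h[of UNIV R] h(3)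
        by (intro weak_conv_imp_integral_bdd_continuous_conv[where B=1])
           (auto simp: continuous_on_eq_continuous_at)
      then show ?thesis using m hm by (simp add: integral_distr)
    qed
    then have "(\<lambda>n. \<Sum>b\<in>Basis. \<integral>x. h R (x \<bullet> b) \<partial>P n) \<longlonglongrightarrow> (\<Sum>b\<in>Basis. \<integral>x. h R (x \<bullet> b) \<partial>Q)"
      by (intro tendsto_sum)
    then show ?thesis
      using int_P[OF cont_hb h(3)] int_Q[OF cont_hb h(3)] unfolding H_def
      by (simp add: Bochner_Integration.integral_sum)
  qed
  have tail0: "(\<lambda>R. \<integral>x. H (real R) x \<partial>Q) \<longlonglongrightarrow> (\<integral>x. 0 \<partial>Q)"
  proof (rule integral_dominated_convergence[where w="\<lambda>_. DIM('a)"])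
    have "(\<lambda>R. h (real R) y) \<longlonglongrightarrow> 0" for y
    proof (rule tendsto_eventually)
      show "\<forall>\<^sub>F R in sequentially. h (real R) y = 0"
        using eventually_ge_at_top[of "nat \<lceil>\<bar>y\<bar>\<rceil>"]
        by eventually_elim (auto simp: h_def)
    qed
    then have "(\<lambda>R. H (real R) x) \<longlonglongrightarrow> 0" for x
      unfolding H_def by (intro tendsto_null_sum)
    then show "AE x in Q. (\<lambda>R. H (real R) x) \<longlonglongrightarrow> 0" by simp
  qed (use HD cont_H in \<open>auto simp: meas_Q intro: borel_measurable_continuous_onI\<close>)
  show "(\<lambda>n. \<integral>x. g x \<partial>P n) \<longlonglongrightarrow> (\<integral>x. g x \<partial>Q)"
  proof (rule tendstoI)
    fix e :: real assume e: "e > 0"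
    \<comment> \<open>\<open>R\<close> is chosen from the limit law alone. The weight
      \<open>2 * B\<close> of \<open>H R\<close> turns this bound into \<open>e / 8\<close>, so each
      of the two approximation errors tends to at most \<open>e / 4\<close>.\<close>
    have "\<forall>\<^sub>F R in sequentially. (\<integral>x. H (real R) x \<partial>Q) < e / (16 * B)"
      using order_tendstoD(2)[OF tail0, of "e / (16 * B)"] e B(1) by simp
    then obtain R :: nat where R: "(\<integral>x. H R x \<partial>Q) < e / (16 * B)"
      by (auto simp: eventually_sequentially)
    have "e / 8 > 0" "real R + 1 > 0" using e by auto
    from real_polynomial_sin_approx[OF g B(2) this]
    obtain T where T: "trig_poly (\<lambda>x. complex_of_real (T x))"
      and T1: "\<And>x. (\<And>b. b \<in> Basis \<Longrightarrow> \<bar>x \<bullet> b\<bar> \<le> real R + 1) \<Longrightarrow> \<bar>T x - g x\<bar> < e / 8"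
      and T2: "\<And>x. \<bar>T x - g x\<bar> < e / 8 + 2 * B" by blast
    have diff: "\<bar>T x - g x\<bar> \<le> e / 8 + 2 * B * H R x" for x
    proof (cases "\<forall>b\<in>Basis. \<bar>x \<bullet> b\<bar> \<le> real R + 1")
      case True
      then have "\<bar>T x - g x\<bar> < e / 8" by (intro T1) auto
      moreover have "0 \<le> 2 * B * H R x" using B(1) H0[of R x] by simp
      ultimately show ?thesis by linarith
    next
      case False
      then obtain b where b: "b \<in> Basis" "\<bar>x \<bullet> b\<bar> > real R + 1" by auto
      then have "1 = h R (x \<bullet> b)" by (simp add: h_def)
      also have "\<dots> \<le> H R x" unfolding H_def using b h(1) by (intro member_le_sum) auto
      finally have "2 * B * 1 \<le> 2 * B * H R x" using B(1) by (intro mult_left_mono) auto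
      then show ?thesis using T2[of x] by linarith
    qed
    have bound: "\<bar>(\<integral>x. T x \<partial>N) - (\<integral>x. g x \<partial>N)\<bar> \<le> e / 8 + 2 * B * (\<integral>x. H R x \<partial>N)"
      if N: "prob_space N" "sets N = sets borel" for N
    proof -
      interpret N: prob_space N by (rule N)
      have mN: "f \<in> borel_measurable N \<longleftrightarrow> f \<in> borel_measurable borel" for f :: "'a \<Rightarrow> real"
        by (simp add: measurable_cong_sets[OF N(2) refl])
      have iT: "integrable N T" using trig_poly_integrable[OF N T]
        by (simp add: complex_of_real_integrable_eq)
      have ig: "integrable N g" using g B(2)
        by (intro N.integrable_const_bound[of _ B]) (auto simp: mN intro: borel_measurable_continuous_onI)
      have iH: "integrable N (H R)" using cont_H HD
        by (intro N.integrable_const_bound[of _ "DIM('a)"]) (auto simp: mN intro: borel_measurable_continuous_onI)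
      have "\<bar>(\<integral>x. T x \<partial>N) - (\<integral>x. g x \<partial>N)\<bar> = \<bar>\<integral>x. T x - g x \<partial>N\<bar>"
        using iT ig by simp
      also have "\<dots> \<le> (\<integral>x. \<bar>T x - g x\<bar> \<partial>N)" by (rule integral_abs_bound)
      also have "\<dots> \<le> (\<integral>x. e / 8 + 2 * B * H R x \<partial>N)"
        using iT ig iH diff by (intro integral_mono) auto
      also have "\<dots> = e / 8 + 2 * B * (\<integral>x. H R x \<partial>N)"
        using iH by (simp add: N.prob_space)
      finally show ?thesis .
    qed
    have Tlim: "(\<lambda>n. \<integral>x. T x \<partial>P n) \<longlonglongrightarrow> (\<integral>x. T x \<partial>Q)"
      using trig_poly_integral_tendsto[OF assms T]
      by (simp add: integral_complex_of_real tendsto_of_real_iff)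
    \<comment> \<open>Triangle inequality through the integrals of \<open>T\<close> under
      \<open>P n\<close> and \<open>Q\<close>: this sum bounds the distance of the integrals of
      \<open>g\<close>.\<close>
    have "(\<lambda>n. \<bar>(\<integral>x. T x \<partial>P n) - (\<integral>x. T x \<partial>Q)\<bar> + (e / 8 + 2 * B * (\<integral>x. H R x \<partial>P n))
         + (e / 8 + 2 * B * (\<integral>x. H R x \<partial>Q)))
       \<longlonglongrightarrow> \<bar>(\<integral>x. T x \<partial>Q) - (\<integral>x. T x \<partial>Q)\<bar> + (e / 8 + 2 * B * (\<integral>x. H R x \<partial>Q))
         + (e / 8 + 2 * B * (\<integral>x. H R x \<partial>Q))"
      by (intro tendsto_intros Tlim tail)
    moreover have "\<bar>(\<integral>x. T x \<partial>Q) - (\<integral>x. T x \<partial>Q)\<bar> + (e / 8 + 2 * B * (\<integral>x. H R x \<partial>Q))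
         + (e / 8 + 2 * B * (\<integral>x. H R x \<partial>Q)) < e"
      using R B(1) e by (simp add: field_simps)
    ultimately have "\<forall>\<^sub>F n in sequentially.
        \<bar>(\<integral>x. T x \<partial>P n) - (\<integral>x. T x \<partial>Q)\<bar> + (e / 8 + 2 * B * (\<integral>x. H R x \<partial>P n))
         + (e / 8 + 2 * B * (\<integral>x. H R x \<partial>Q)) < e"
      by (rule order_tendstoD(2))
    then show "\<forall>\<^sub>F n in sequentially. dist (\<integral>x. g x \<partial>P n) (\<integral>x. g x \<partial>Q) < e"
    proof eventually_elim
      case (elim n)
      then show ?case
        using bound[OF prob_P[of n] sets_P[of n]] bound[OF prob_Q sets_Q]
        unfolding dist_real_def by linarith
    qed
  qed
qed

section \<open>Characteristic functions of locally dependent sums\<close>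

lemma iexp_approx_1: "cmod (iexp x - 1 - \<i> * x) \<le> x\<^sup>2 / 2"
  using iexp_approx1[of x 1] by (simp add: power2_eq_square algebra_simps)

text \<open>The product is at most the cube of its largest factor. This bounds mixed third moments
  by third moments and, with some factors equal to \<open>1\<close>, yields integrability of lower
  powers.\<close>

lemma abs_triple_product_le:
  fixes a b c :: real
  shows "\<bar>a\<bar> * \<bar>b\<bar> * \<bar>c\<bar> \<le> \<bar>a\<bar> ^ 3 + \<bar>b\<bar> ^ 3 + \<bar>c\<bar> ^ 3"
proof -
  define m where "m = max \<bar>a\<bar> (max \<bar>b\<bar> \<bar>c\<bar>)"
  have "\<bar>a\<bar> * \<bar>b\<bar> * \<bar>c\<bar> \<le> m * m * m"
    unfolding m_def by (intro mult_mono) auto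
  also have "\<dots> = m ^ 3" by (simp add: power3_eq_cube)
  also have "\<dots> \<le> \<bar>a\<bar> ^ 3 + \<bar>b\<bar> ^ 3 + \<bar>c\<bar> ^ 3"
    unfolding m_def by (auto simp: max_def)
  finally show ?thesis .
qed

text \<open>Integrating factor: \<open>exp (s\<^sup>2 * v / 2)\<close> times \<open>\<phi> s\<close>
  has derivative of norm at most \<open>exp (v / 2) * \<delta>\<close> on the unit interval. The
  mean value inequality applies, and undoing the factor at \<open>s = 1\<close> cancels
  \<open>exp (v / 2)\<close>.\<close>

lemma gaussian_char_bound_of_derivative:
  fixes \<phi> :: "real \<Rightarrow> complex" and v :: real
  assumes der: "\<And>s. (\<phi> has_vector_derivative \<phi>' s) (at s)"
    and bnd: "\<And>s. 0 \<le> s \<Longrightarrow> s \<le> 1 \<Longrightarrow> cmod (\<phi>' s + s * v * \<phi> s) \<le> \<delta>"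
    and "\<phi> 0 = 1" "v \<ge> 0"
  shows "cmod (\<phi> 1 - of_real (exp (- v / 2))) \<le> \<delta>"
proof -
  define G where "G s = exp (s\<^sup>2 * v / 2) *\<^sub>R \<phi> s" for s
  have \<delta>: "\<delta> \<ge> 0" using bnd[of 0] norm_ge_zero[of "\<phi>' 0"] by (simp, linarith)
  have G': "(G has_vector_derivative exp (s\<^sup>2 * v / 2) *\<^sub>R (\<phi>' s + s * v * \<phi> s)) (at s)" for s
  proof -
    have "((\<lambda>s. exp (s\<^sup>2 * v / 2)) has_field_derivative exp (s\<^sup>2 * v / 2) * (s * v)) (at s)"
      by (auto intro!: derivative_eq_intros)
    from has_vector_derivative_scaleR[OF this der[of s]]
    show ?thesis unfolding G_def
      by (simp add: scaleR_conv_of_real algebra_simps)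
  qed
  have "cmod (G 1 - G 0) \<le> exp (v / 2) * \<delta>"
  proof -
    have "cmod (G 1 - G 0) \<le> exp (v / 2) * \<delta> * norm (1 - 0 :: real)"
    proof (rule differentiable_bound[of "{0..1}" G "\<lambda>s x. x *\<^sub>R (exp (s\<^sup>2 * v / 2) *\<^sub>R (\<phi>' s + s * v * \<phi> s))"])
      fix s :: real assume s: "s \<in> {0..1}"
      show "(G has_derivative (\<lambda>x. x *\<^sub>R (exp (s\<^sup>2 * v / 2) *\<^sub>R (\<phi>' s + s * v * \<phi> s)))) (at s within {0..1})"
        using G'[of s] unfolding has_vector_derivative_def by (rule has_derivative_at_withinI)
      have "s\<^sup>2 * v \<le> 1 * v" using s \<open>v \<ge> 0\<close> by (intro mult_right_mono) (auto simp: power_le_one)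
      then have "cmod (exp (s\<^sup>2 * v / 2) *\<^sub>R (\<phi>' s + s * v * \<phi> s)) \<le> exp (v / 2) * \<delta>"
        using bnd[of s] s \<delta> unfolding norm_scaleR by (intro mult_mono) auto
      then show "onorm (\<lambda>x. x *\<^sub>R (exp (s\<^sup>2 * v / 2) *\<^sub>R (\<phi>' s + s * v * \<phi> s))) \<le> exp (v / 2) * \<delta>"
        by (intro onorm_le) (simp only: norm_scaleR[where 'a=complex] real_norm_def mult.commute[of "\<bar>_\<bar>"],
            intro mult_right_mono, auto)
    qed auto
    then show ?thesis by simp
  qed
  moreover have "\<phi> 1 - of_real (exp (- v / 2)) = exp (- v / 2) *\<^sub>R (G 1 - G 0)"
    using \<open>\<phi> 0 = 1\<close>
    by (simp add: G_def scaleR_conv_of_real right_diff_distrib exp_of_real[symmetric] mult_exp_exp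
        flip: mult.assoc)
  ultimately have "cmod (\<phi> 1 - of_real (exp (- v / 2))) \<le> exp (- v / 2) * (exp (v / 2) * \<delta>)"
    by (simp only: norm_scaleR abs_exp_cancel) (simp add: mult_left_mono)
  then show ?thesis
    by (simp add: mult_exp_exp flip: mult.assoc)
qed

text \<open>Differentiation under the expectation. The Taylor bound for \<open>iexp\<close>,
  integrated, leaves a remainder of at most \<open>(u - s)\<^sup>2\<close> times half the second
  moment, and this is \<open>o(u - s)\<close>.\<close>

lemma (in prob_space) has_vector_derivative_expectation_iexp:
  fixes Y :: "'a \<Rightarrow> real"
  assumes [measurable]: "Y \<in> borel_measurable M" and Y2: "integrable M (\<lambda>\<omega>. (Y \<omega>)\<^sup>2)"
  shows "((\<lambda>s. CLINT \<omega>|M. iexp (s * Y \<omega>)) has_vector_derivative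
    (CLINT \<omega>|M. \<i> * Y \<omega> * iexp (s * Y \<omega>))) (at s)"
proof -
  let ?\<phi> = "\<lambda>s. CLINT \<omega>|M. iexp (s * Y \<omega>)"
  let ?D = "CLINT \<omega>|M. \<i> * Y \<omega> * iexp (s * Y \<omega>)"
  have Y1: "integrable M Y"
    by (rule square_integrable_imp_integrable[OF assms])
  have i0: "integrable M (\<lambda>\<omega>. iexp (u * Y \<omega>))" for u
    by (rule integrable_iexp) auto
  have i1: "integrable M (\<lambda>\<omega>. \<i> * Y \<omega> * iexp (s * Y \<omega>))"
    by (rule Bochner_Integration.integrable_bound[OF Y1]) (auto simp: norm_mult)
  have quad: "cmod (?\<phi> u - ?\<phi> s - (u - s) *\<^sub>R ?D) \<le> (u - s)\<^sup>2 * (expectation (\<lambda>\<omega>. (Y \<omega>)\<^sup>2) / 2)" for u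
  proof -
    have "?\<phi> u - ?\<phi> s - (u - s) *\<^sub>R ?D =
        (CLINT \<omega>|M. iexp (u * Y \<omega>) - iexp (s * Y \<omega>) - (u - s) *\<^sub>R (\<i> * Y \<omega> * iexp (s * Y \<omega>)))"
      using i0 i1 by simp
    also have "cmod \<dots> \<le> (\<integral>\<omega>. (u - s)\<^sup>2 * ((Y \<omega>)\<^sup>2 / 2) \<partial>M)"
    proof (intro order_trans[OF integral_norm_bound] integral_mono)
      fix \<omega>
      have "iexp (u * Y \<omega>) = iexp (s * Y \<omega>) * iexp ((u - s) * Y \<omega>)"
        by (simp add: exp_add[symmetric] algebra_simps)
      then have "iexp (u * Y \<omega>) - iexp (s * Y \<omega>) - (u - s) *\<^sub>R (\<i> * Y \<omega> * iexp (s * Y \<omega>))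
          = iexp (s * Y \<omega>) * (iexp ((u - s) * Y \<omega>) - 1 - \<i> * ((u - s) * Y \<omega>))"
        by (simp add: scaleR_conv_of_real algebra_simps)
      then show "cmod (iexp (u * Y \<omega>) - iexp (s * Y \<omega>) - (u - s) *\<^sub>R (\<i> * Y \<omega> * iexp (s * Y \<omega>)))
          \<le> (u - s)\<^sup>2 * ((Y \<omega>)\<^sup>2 / 2)"
        using iexp_approx_1[of "(u - s) * Y \<omega>"] by (simp add: norm_mult power_mult_distrib)
    qed (use i0 i1 Y2 in auto)
    finally show ?thesis by simp
  qed
  show ?thesis
    unfolding has_vector_derivative_def
  proof (rule has_derivativeI)
    show "bounded_linear (\<lambda>x. x *\<^sub>R ?D)" by (rule bounded_linear_scaleR_left)
    have lim: "((\<lambda>u. \<bar>u - s\<bar> * (expectation (\<lambda>\<omega>. (Y \<omega>)\<^sup>2) / 2)) \<longlongrightarrow> \<bar>s - s\<bar> * (expectation (\<lambda>\<omega>. (Y \<omega>)\<^sup>2) / 2)) (at s)"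
      by (intro tendsto_intros)
    show "((\<lambda>u. (?\<phi> u - ?\<phi> s - (u - s) *\<^sub>R ?D) /\<^sub>R norm (u - s)) \<longlongrightarrow> 0) (at s)"
    proof (rule Lim_null_comparison)
      show "\<forall>\<^sub>F u in at s. norm ((?\<phi> u - ?\<phi> s - (u - s) *\<^sub>R ?D) /\<^sub>R norm (u - s))
          \<le> \<bar>u - s\<bar> * (expectation (\<lambda>\<omega>. (Y \<omega>)\<^sup>2) / 2)"
      proof (rule eventually_mono[OF eventually_neq_at_within[of s]])
        fix u :: real assume "u \<noteq> s"
        then show "norm ((?\<phi> u - ?\<phi> s - (u - s) *\<^sub>R ?D) /\<^sub>R norm (u - s))
            \<le> \<bar>u - s\<bar> * (expectation (\<lambda>\<omega>. (Y \<omega>)\<^sup>2) / 2)"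
          using quad[of u]
          by (simp add: divide_inverse_commute[symmetric] divide_le_eq power2_eq_square abs_mult[symmetric] mult_ac
              del: of_real_mult of_real_diff)
      qed
    qed (use lim in simp)
  qed
qed

section \<open>A quantitative bound for locally dependent sums\<close>

text \<open>The estimate for one row of the array; the dependence structure enters only through
  \<open>ortho\<close>. In the error term, each \<open>k\<close> contributes
  \<open>r ^ 3 / 2\<close> times a sum over at most \<open>m\<^sup>2\<close> pairs of neighbours,
  whose mixed moments are at most \<open>3 * C\<close>, where
  \<open>r = 1 / sqrt (card K)\<close>.\<close>

lemma (in prob_space) expectation_iexp_local_dependence:
  fixes Y :: "'i \<Rightarrow> 'a \<Rightarrow> real" and nb :: "'i \<Rightarrow> 'i set" and v C :: real and m :: nat
  assumes K: "finite K" "K \<noteq> {}"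
    and nb: "\<And>k. k \<in> K \<Longrightarrow> nb k \<subseteq> K" "\<And>k. k \<in> K \<Longrightarrow> card (nb k) \<le> m"
    and meas[measurable]: "\<And>k. k \<in> K \<Longrightarrow> Y k \<in> borel_measurable M"
    and int3: "\<And>k. k \<in> K \<Longrightarrow> integrable M (\<lambda>\<omega>. \<bar>Y k \<omega>\<bar> ^ 3)"
    and C: "\<And>k. k \<in> K \<Longrightarrow> expectation (\<lambda>\<omega>. \<bar>Y k \<omega>\<bar> ^ 3) \<le> C"
    and ortho: "\<And>k s. k \<in> K \<Longrightarrow> (CLINT \<omega>|M. Y k \<omega> * iexp (s * (\<Sum>j\<in>K - nb k. Y j \<omega>))) = 0"
    and v: "0 \<le> v"
  shows "cmod ((CLINT \<omega>|M. iexp ((\<Sum>k\<in>K. Y k \<omega>) / sqrt (card K))) - of_real (exp (- v / 2)))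
    \<le> expectation (\<lambda>\<omega>. \<bar>(\<Sum>k\<in>K. \<Sum>j\<in>nb k. Y k \<omega> * Y j \<omega>) / card K - v\<bar>)
      + 3 / 2 * (real m)\<^sup>2 * C / sqrt (card K)"
proof -
  define r where "r = 1 / sqrt (card K)"
  have r: "r > 0" "r\<^sup>2 * card K = 1" "r\<^sup>2 = 1 / card K"
    using K by (auto simp: r_def card_gt_0_iff power_divide)
  have nbK: "j \<in> K" if "k \<in> K" "j \<in> nb k" for k j using nb(1)[OF that(1)] that(2) by auto
  have fin: "finite (nb k)" if "k \<in> K" for k using finite_subset[OF nb(1)[OF that] K(1)] .
  have C0: "C \<ge> 0"
  proof -
    obtain k where k: "k \<in> K" using K by auto
    have "0 \<le> expectation (\<lambda>\<omega>. \<bar>Y k \<omega>\<bar> ^ 3)" by (intro Bochner_Integration.integral_nonneg) auto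
    with C[OF k] show ?thesis by linarith
  qed
  have i3: "integrable M (\<lambda>\<omega>. \<bar>Y i \<omega>\<bar> * \<bar>Y j \<omega>\<bar> * \<bar>Y l \<omega>\<bar>)"
    and e3: "expectation (\<lambda>\<omega>. \<bar>Y i \<omega>\<bar> * \<bar>Y j \<omega>\<bar> * \<bar>Y l \<omega>\<bar>) \<le> 3 * C"
    if "i \<in> K" "j \<in> K" "l \<in> K" for i j l
  proof -
    note [measurable] = that[THEN meas]
    have s: "integrable M (\<lambda>\<omega>. \<bar>Y i \<omega>\<bar> ^ 3 + \<bar>Y j \<omega>\<bar> ^ 3 + \<bar>Y l \<omega>\<bar> ^ 3)"
      using int3 that by simp
    show i: "integrable M (\<lambda>\<omega>. \<bar>Y i \<omega>\<bar> * \<bar>Y j \<omega>\<bar> * \<bar>Y l \<omega>\<bar>)"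
      by (rule Bochner_Integration.integrable_bound[OF s])
        (auto simp: abs_mult intro!: AE_I2 order_trans[OF abs_triple_product_le])
    have "expectation (\<lambda>\<omega>. \<bar>Y i \<omega>\<bar> * \<bar>Y j \<omega>\<bar> * \<bar>Y l \<omega>\<bar>)
        \<le> expectation (\<lambda>\<omega>. \<bar>Y i \<omega>\<bar> ^ 3 + \<bar>Y j \<omega>\<bar> ^ 3 + \<bar>Y l \<omega>\<bar> ^ 3)"
      by (intro integral_mono i s abs_triple_product_le)
    also have "\<dots> \<le> 3 * C"
      using C[OF that(1)] C[OF that(2)] C[OF that(3)] int3 that by simp
    finally show "expectation (\<lambda>\<omega>. \<bar>Y i \<omega>\<bar> * \<bar>Y j \<omega>\<bar> * \<bar>Y l \<omega>\<bar>) \<le> 3 * C" .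
  qed
  have i2: "integrable M (\<lambda>\<omega>. Y i \<omega> * Y j \<omega>)" if "i \<in> K" "j \<in> K" for i j
  proof -
    note [measurable] = that[THEN meas]
    \<comment> \<open>The last summand is the cube of the third factor \<open>1\<close> in the
      triple product bound.\<close>
    have s: "integrable M (\<lambda>\<omega>. \<bar>Y i \<omega>\<bar> ^ 3 + \<bar>Y j \<omega>\<bar> ^ 3 + \<bar>1\<bar> ^ 3)"
      using int3 that by simp
    have "\<bar>Y i \<omega> * Y j \<omega>\<bar> \<le> \<bar>Y i \<omega>\<bar> ^ 3 + \<bar>Y j \<omega>\<bar> ^ 3 + \<bar>1\<bar> ^ 3" for \<omega>
      using abs_triple_product_le[of "Y i \<omega>" "Y j \<omega>" 1] by (simp add: abs_mult)
    then show ?thesis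
      by (intro Bochner_Integration.integrable_bound[OF s]) (auto intro!: AE_I2 order_trans[OF _ abs_ge_self])
  qed
  have i1: "integrable M (Y i)" if "i \<in> K" for i
    using i2[OF that that]
    by (intro square_integrable_imp_integrable[OF meas[OF that]]) (simp add: power2_eq_square)
  \<comment> \<open>\<open>D k\<close> is the share of the neighbours of \<open>k\<close> in
    \<open>W\<close>, so that \<open>W = D k + T k\<close>; it is the small increment in the
    expansion below.\<close>
  define W where "W \<omega> = r * (\<Sum>k\<in>K. Y k \<omega>)" for \<omega>
  define D where "D k \<omega> = r * (\<Sum>j\<in>nb k. Y j \<omega>)" for k \<omega>
  define T where "T k \<omega> = r * (\<Sum>j\<in>K - nb k. Y j \<omega>)" for k \<omega>
  define V where "V \<omega> = (\<Sum>k\<in>K. \<Sum>j\<in>nb k. Y k \<omega> * Y j \<omega>) / card K" for \<omega>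
  have WDT: "W \<omega> = D k \<omega> + T k \<omega>" if "k \<in> K" for k \<omega>
    unfolding W_def D_def T_def using sum.subset_diff[OF nb(1)[OF that] K(1), of "\<lambda>k. Y k \<omega>"]
    by (simp add: algebra_simps)
  have VD: "V \<omega> = (\<Sum>k\<in>K. r * Y k \<omega> * D k \<omega>)" for \<omega>
  proof -
    have "r * Y k \<omega> * D k \<omega> = r\<^sup>2 * (Y k \<omega> * (\<Sum>j\<in>nb k. Y j \<omega>))" for k
      by (simp add: D_def power2_eq_square)
    then show ?thesis
      by (simp add: V_def r(3) sum_divide_distrib flip: sum_distrib_left)
  qed
  have [measurable]: "W \<in> borel_measurable M" unfolding W_def by measurable
  have mD[measurable]: "D k \<in> borel_measurable M" if "k \<in> K" for k
    unfolding D_def using nbK[OF that] by measurable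
  have mT[measurable]: "T k \<in> borel_measurable M" if "k \<in> K" for k
    unfolding T_def by measurable
  have iW2: "integrable M (\<lambda>\<omega>. (W \<omega>)\<^sup>2)"
  proof -
    have "(W \<omega>)\<^sup>2 = r\<^sup>2 * (\<Sum>i\<in>K. \<Sum>j\<in>K. Y i \<omega> * Y j \<omega>)" for \<omega>
      by (simp add: W_def power_mult_distrib power2_eq_square[of "sum _ _"] sum_product)
    then show ?thesis using i2 by simp
  qed
  have iV: "integrable M V"
    unfolding V_def using i2 nbK
    by (intro integrable_divide Bochner_Integration.integrable_sum) auto
  define \<phi> where "\<phi> s = (CLINT \<omega>|M. iexp (s * W \<omega>))" for s
  define \<phi>' where "\<phi>' s = (CLINT \<omega>|M. \<i> * W \<omega> * iexp (s * W \<omega>))" for s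
  have ie: "integrable M (\<lambda>\<omega>. iexp (s * W \<omega>))" for s
    by (rule integrable_iexp) auto
  have iWe: "integrable M (\<lambda>\<omega>. \<i> * W \<omega> * iexp (s * W \<omega>))" for s
    using square_integrable_imp_integrable[OF _ iW2]
    by (rule Bochner_Integration.integrable_bound) (auto simp: norm_mult)
  have iVe: "integrable M (\<lambda>\<omega>. s * V \<omega> * iexp (s * W \<omega>))" for s
    using integrable_mult_right[OF iV, of s]
    by (rule Bochner_Integration.integrable_bound) (use iV in \<open>auto simp: norm_mult abs_mult\<close>)
  have bnd: "cmod (\<phi>' s + s * v * \<phi> s) \<le> expectation (\<lambda>\<omega>. \<bar>V \<omega> - v\<bar>) + 3 / 2 * (real m)\<^sup>2 * C * r"
    if s: "0 \<le> s" "s \<le> 1" for s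
  proof -
    \<comment> \<open>The remainder left when \<open>iexp (s * W) - iexp (s * T k)\<close> is
      replaced by its first-order term in \<open>D k\<close>. Its bound \<open>A k\<close> is the
      quadratic Taylor estimate with the square of the sum over neighbours multiplied out.\<close>
    define R where "R k \<omega> = \<i> * r * Y k \<omega> * (iexp (s * W \<omega>) - iexp (s * T k \<omega>) - \<i> * s * D k \<omega> * iexp (s * W \<omega>))"
      for k \<omega>
    define A where "A k \<omega> = r ^ 3 / 2 * (\<Sum>i\<in>nb k. \<Sum>l\<in>nb k. \<bar>Y k \<omega>\<bar> * \<bar>Y i \<omega>\<bar> * \<bar>Y l \<omega>\<bar>)" for k \<omega>
    have RA: "cmod (R k \<omega>) \<le> A k \<omega>" if k: "k \<in> K" for k \<omega>
    proof -
      \<comment> \<open>Expanding around \<open>W\<close> rather than \<open>T k\<close> leaves the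
        common factor \<open>iexp (s * W)\<close> on the first-order terms, which is what lets them
        add up to \<open>V\<close>.\<close>
      have "iexp (s * T k \<omega>) = iexp (s * W \<omega>) * iexp (- s * D k \<omega>)"
        by (simp add: WDT[OF k] exp_add[symmetric] algebra_simps)
      then have "iexp (s * W \<omega>) - iexp (s * T k \<omega>) - \<i> * s * D k \<omega> * iexp (s * W \<omega>)
          = - (iexp (s * W \<omega>) * (iexp (- s * D k \<omega>) - 1 - \<i> * (- s * D k \<omega>)))"
        by (simp add: algebra_simps)
      then have "cmod (R k \<omega>) = r * \<bar>Y k \<omega>\<bar> * cmod (iexp (- s * D k \<omega>) - 1 - \<i> * (- s * D k \<omega>))"
        using r(1) unfolding R_def by (simp only: norm_mult norm_minus_cancel) simp
      also have "\<dots> \<le> r * \<bar>Y k \<omega>\<bar> * ((- s * D k \<omega>)\<^sup>2 / 2)"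
        using r(1) by (intro mult_left_mono iexp_approx_1) auto
      also have "\<dots> \<le> r * \<bar>Y k \<omega>\<bar> * ((D k \<omega>)\<^sup>2 / 2)"
      proof -
        have "(- s * D k \<omega>)\<^sup>2 \<le> 1 * (D k \<omega>)\<^sup>2"
          unfolding power_mult_distrib using s by (intro mult_right_mono) (auto simp: power_le_one)
        then show ?thesis using r(1) by (intro mult_left_mono) auto
      qed
      also have "\<dots> \<le> r * \<bar>Y k \<omega>\<bar> * ((r * (\<Sum>j\<in>nb k. \<bar>Y j \<omega>\<bar>))\<^sup>2 / 2)"
      proof -
        have "\<bar>D k \<omega>\<bar> \<le> r * (\<Sum>j\<in>nb k. \<bar>Y j \<omega>\<bar>)"
          using r(1) unfolding D_def by (simp add: abs_mult sum_abs)
        then have "(D k \<omega>)\<^sup>2 \<le> (r * (\<Sum>j\<in>nb k. \<bar>Y j \<omega>\<bar>))\<^sup>2"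
          by (metis abs_le_square_iff abs_ge_self order_trans)
        then show ?thesis using r(1) by (intro mult_left_mono) auto
      qed
      also have "\<dots> = A k \<omega>"
        by (simp add: A_def power_mult_distrib power2_eq_square[of "sum _ _"] sum_product
            sum_distrib_left power3_eq_cube power2_eq_square mult_ac)
      finally show ?thesis .
    qed
    have iA: "integrable M (A k)" if "k \<in> K" for k
      unfolding A_def using i3 nbK that by auto
    have mR: "R k \<in> borel_measurable M" if k: "k \<in> K" for k
      unfolding R_def using meas[OF k] mD[OF k] mT[OF k] by measurable
    have iR: "integrable M (R k)" if k: "k \<in> K" for k
      by (rule Bochner_Integration.integrable_bound[OF iA[OF k] mR[OF k]])
        (auto intro!: AE_I2 order_trans[OF RA[OF k]])
    have eA: "expectation (A k) \<le> r ^ 3 / 2 * ((real m)\<^sup>2 * (3 * C))" if k: "k \<in> K" for k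
    proof -
      have "expectation (A k)
          = r ^ 3 / 2 * (\<Sum>i\<in>nb k. \<Sum>l\<in>nb k. expectation (\<lambda>\<omega>. \<bar>Y k \<omega>\<bar> * \<bar>Y i \<omega>\<bar> * \<bar>Y l \<omega>\<bar>))"
        unfolding A_def using i3 nbK k
        by (simp add: Bochner_Integration.integral_sum Bochner_Integration.integrable_sum)
      also have "\<dots> \<le> r ^ 3 / 2 * (\<Sum>i\<in>nb k. \<Sum>l\<in>nb k. 3 * C)"
        using r(1) e3 nbK k by (intro mult_left_mono sum_mono) auto
      also have "(\<Sum>i\<in>nb k. \<Sum>l\<in>nb k. 3 * C) = (real (card (nb k)))\<^sup>2 * (3 * C)"
        by (simp add: power2_eq_square)
      also have "r ^ 3 / 2 * \<dots> \<le> r ^ 3 / 2 * ((real m)\<^sup>2 * (3 * C))"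
        using r(1) nb(2)[OF k] C0 by (intro mult_left_mono mult_right_mono power_mono) auto
      finally show ?thesis .
    qed
    have iT: "integrable M (\<lambda>\<omega>. Y k \<omega> * iexp (s * T k \<omega>))" if k: "k \<in> K" for k
      by (rule Bochner_Integration.integrable_bound[OF i1[OF k]])
        (use meas[OF k] mT[OF k] in \<open>auto simp: norm_mult\<close>)
    \<comment> \<open>The normalisation \<open>r\<close> inside \<open>T k\<close> is absorbed into
      the frequency, which \<open>ortho\<close> leaves free.\<close>
    have oT: "(CLINT \<omega>|M. Y k \<omega> * iexp (s * T k \<omega>)) = 0" if k: "k \<in> K" for k
      using ortho[OF k, of "s * r"] by (simp add: T_def mult.assoc)
    \<comment> \<open>Summed over \<open>k\<close>, the terms \<open>r * Y k\<close> give
      \<open>W\<close>, and the first-order terms give \<open>V\<close> with sign \<open>+\<close>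
      since \<open>\<i> * (- \<i>) = 1\<close>. The last sum has expectation \<open>0\<close> by
      \<open>oT\<close>, so only the remainders survive.\<close>
    have split: "\<i> * W \<omega> * iexp (s * W \<omega>) + s * V \<omega> * iexp (s * W \<omega>)
        = (\<Sum>k\<in>K. R k \<omega>) + \<i> * r * (\<Sum>k\<in>K. Y k \<omega> * iexp (s * T k \<omega>))" for \<omega>
    proof -
      have "R k \<omega> + \<i> * r * (Y k \<omega> * iexp (s * T k \<omega>))
          = (\<i> * iexp (s * W \<omega>)) * of_real (r * Y k \<omega>) + (s * iexp (s * W \<omega>)) * of_real (r * Y k \<omega> * D k \<omega>)" for k
        by (simp add: R_def algebra_simps)
      then have "(\<Sum>k\<in>K. R k \<omega>) + \<i> * r * (\<Sum>k\<in>K. Y k \<omega> * iexp (s * T k \<omega>))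
          = (\<i> * iexp (s * W \<omega>)) * of_real (\<Sum>k\<in>K. r * Y k \<omega>)
            + (s * iexp (s * W \<omega>)) * of_real (\<Sum>k\<in>K. r * Y k \<omega> * D k \<omega>)"
        by (simp only: sum_distrib_left of_real_sum sum.distrib[symmetric])
      moreover have WS: "(\<Sum>k\<in>K. r * Y k \<omega>) = W \<omega>"
        by (simp add: W_def sum_distrib_left)
      ultimately show ?thesis
        by (simp only: VD[symmetric] WS) (simp add: mult_ac)
    qed
    have "\<phi>' s + (CLINT \<omega>|M. s * V \<omega> * iexp (s * W \<omega>)) = (\<Sum>k\<in>K. expectation (R k))"
    proof -
      have "\<phi>' s + (CLINT \<omega>|M. s * V \<omega> * iexp (s * W \<omega>))
        = (CLINT \<omega>|M. (\<Sum>k\<in>K. R k \<omega>) + \<i> * r * (\<Sum>k\<in>K. Y k \<omega> * iexp (s * T k \<omega>)))"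
        unfolding \<phi>'_def split[symmetric]
        by (rule Bochner_Integration.integral_add[symmetric, OF iWe iVe])
      also have "\<dots> = (\<Sum>k\<in>K. expectation (R k))
          + \<i> * r * (\<Sum>k\<in>K. CLINT \<omega>|M. Y k \<omega> * iexp (s * T k \<omega>))"
        using iR iT by (simp add: Bochner_Integration.integral_sum Bochner_Integration.integrable_sum)
      finally show ?thesis using oT by simp
    qed
    moreover have "cmod (\<Sum>k\<in>K. expectation (R k)) \<le> (\<Sum>k\<in>K. r ^ 3 / 2 * ((real m)\<^sup>2 * (3 * C)))"
    proof (intro order_trans[OF norm_sum] sum_mono)
      fix k assume k: "k \<in> K"
      have "cmod (expectation (R k)) \<le> expectation (A k)"
        using iR[OF k] iA[OF k] RA[OF k]
        by (intro order_trans[OF integral_norm_bound] integral_mono) auto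
      then show "cmod (expectation (R k)) \<le> r ^ 3 / 2 * ((real m)\<^sup>2 * (3 * C))"
        using eA[OF k] by linarith
    qed
    moreover have "(\<Sum>k\<in>K. r ^ 3 / 2 * ((real m)\<^sup>2 * (3 * C))) = 3 / 2 * (real m)\<^sup>2 * C * r"
    proof -
      \<comment> \<open>Of the three factors \<open>r\<close>, two cancel the number of summands;
        the third gives the rate.\<close>
      have "(\<Sum>k\<in>K. r ^ 3 / 2 * ((real m)\<^sup>2 * (3 * C))) = (r\<^sup>2 * card K) * (3 / 2 * (real m)\<^sup>2 * C * r)"
        by (simp add: power3_eq_cube power2_eq_square)
      then show ?thesis by (simp only: r(2) mult_1)
    qed
    moreover have "cmod ((CLINT \<omega>|M. s * V \<omega> * iexp (s * W \<omega>)) - s * v * \<phi> s) \<le> expectation (\<lambda>\<omega>. \<bar>V \<omega> - v\<bar>)"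
    proof -
      have "(CLINT \<omega>|M. s * V \<omega> * iexp (s * W \<omega>)) - s * v * \<phi> s
          = (CLINT \<omega>|M. s * V \<omega> * iexp (s * W \<omega>) - s * v * iexp (s * W \<omega>))"
        unfolding \<phi>_def using iVe[of s] ie[of s] by simp
      also have "cmod \<dots> \<le> expectation (\<lambda>\<omega>. \<bar>V \<omega> - v\<bar>)"
      proof (intro order_trans[OF integral_norm_bound] integral_mono)
        fix \<omega>
        have "s * V \<omega> * iexp (s * W \<omega>) - s * v * iexp (s * W \<omega>)
            = of_real (s * (V \<omega> - v)) * iexp (s * W \<omega>)"
          by (simp add: algebra_simps)
        then have "cmod (s * V \<omega> * iexp (s * W \<omega>) - s * v * iexp (s * W \<omega>)) = s * \<bar>V \<omega> - v\<bar>"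
          using s(1) by (simp only: norm_mult norm_of_real norm_exp_i_times) (simp add: abs_mult)
        also have "\<dots> \<le> \<bar>V \<omega> - v\<bar>" using s by (simp add: mult_left_le_one_le)
        finally show "cmod (s * V \<omega> * iexp (s * W \<omega>) - s * v * iexp (s * W \<omega>)) \<le> \<bar>V \<omega> - v\<bar>" .
      qed (use iVe[of s] ie[of s] iV in auto)
      finally show ?thesis .
    qed
    moreover
    \<comment> \<open>The first bracket is the sum of the remainders; the second is the cost of
      replacing the random \<open>V\<close> by the constant \<open>v\<close>.\<close>
    have "\<phi>' s + s * v * \<phi> s = (\<phi>' s + (CLINT \<omega>|M. s * V \<omega> * iexp (s * W \<omega>)))
        - ((CLINT \<omega>|M. s * V \<omega> * iexp (s * W \<omega>)) - s * v * \<phi> s)" by simp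
    then have "cmod (\<phi>' s + s * v * \<phi> s) \<le> cmod (\<phi>' s + (CLINT \<omega>|M. s * V \<omega> * iexp (s * W \<omega>)))
        + cmod ((CLINT \<omega>|M. s * V \<omega> * iexp (s * W \<omega>)) - s * v * \<phi> s)"
      by (simp only: norm_triangle_ineq4)
    ultimately show ?thesis
      by (simp only:)
  qed
  have "cmod (\<phi> 1 - of_real (exp (- v / 2))) \<le> expectation (\<lambda>\<omega>. \<bar>V \<omega> - v\<bar>) + 3 / 2 * (real m)\<^sup>2 * C * r"
  proof (rule gaussian_char_bound_of_derivative)
    show "(\<phi> has_vector_derivative \<phi>' s) (at s)" for s
      unfolding \<phi>_def[abs_def] \<phi>'_def by (rule has_vector_derivative_expectation_iexp[OF _ iW2]) simp
    show "\<phi> 0 = 1" by (simp add: \<phi>_def prob_space)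
  qed (use bnd v in auto)
  then show ?thesis by (simp add: \<phi>_def W_def V_def r_def)
qed

section \<open>Random fields on the lattice\<close>

lemma unorm_le_iff: "unorm (i :: int ^ 'd) \<le> c \<longleftrightarrow> (\<forall>l. \<bar>i $ l\<bar> \<le> c)"
  unfolding unorm_def by (subst Max_le_iff) auto

lemma finite_I0: "finite (I0 :: (int ^ 'd) set)"
proof (rule finite_subset)
  show "(I0 :: (int ^ 'd) set) \<subseteq> vec_lambda ` (PiE UNIV (\<lambda>_. {-1..1}))"
  proof
    fix i :: "int ^ 'd" assume "i \<in> I0"
    then have "vec_nth i \<in> PiE UNIV (\<lambda>_. {-1..1})"
      by (auto simp: I0_def unorm_le_iff abs_le_iff)
    then show "i \<in> vec_lambda ` (PiE UNIV (\<lambda>_. {-1..1}))"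
      by (metis vec_nth_inverse imageI)
  qed
  show "finite (vec_lambda ` (PiE UNIV (\<lambda>_. {-1..1})) :: (int ^ 'd) set)"
    by (intro finite_imageI finite_PiE) auto
qed

text \<open>Translation by \<open>- k\<close> embeds the neighbours into \<open>I0\<close>. The
  bound is the same for all sites and index sets, hence uniform along the array.\<close>

lemma card_neighbours_le:
  fixes k :: "int ^ 'd"
  shows "card {j \<in> K. unorm (j - k) \<le> 1} \<le> card (I0 :: (int ^ 'd) set)"
  by (rule card_inj_on_le[of "\<lambda>j. j - k"]) (auto simp: inj_on_def I0_def finite_I0[unfolded I0_def])

lemma measurable_sigma_gen_vars:
  assumes "j \<in> J" "X j \<in> M \<rightarrow>\<^sub>M S"
  shows "X j \<in> sigma_gen_vars M S J X \<rightarrow>\<^sub>M S"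
proof (rule measurableI)
  let ?G = "{X j -` A \<inter> space M | j A. j \<in> J \<and> A \<in> sets S}"
  have G: "?G \<subseteq> Pow (space M)" by auto
  show "X j x \<in> space S" if "x \<in> space (sigma_gen_vars M S J X)" for x
    using that measurable_space[OF assms(2)] G by (simp add: sigma_gen_vars_def space_measure_of)
  show "X j -` A \<inter> space (sigma_gen_vars M S J X) \<in> sets (sigma_gen_vars M S J X)"
    if "A \<in> sets S" for A
    using that assms(1) G unfolding sigma_gen_vars_def
    by (auto simp: space_measure_of sets_measure_of)
qed

text \<open>The domain \<open>N\<close> is left free so that it can be the whole probability space
  or the \<sigma>-algebra generated by all variables except one.\<close>

lemma measurable_local_function:
  assumes "g \<in> (\<Pi>\<^sub>M i\<in>I. S) \<rightarrow>\<^sub>M borel" "\<And>i. i \<in> I \<Longrightarrow> X (k + i) \<in> N \<rightarrow>\<^sub>M S"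
  shows "(\<lambda>\<omega>. g (\<lambda>i\<in>I. X (k + i) \<omega>)) \<in> N \<rightarrow>\<^sub>M borel"
  by (rule measurable_compose[OF measurable_restrict assms(1)]) (rule assms(2))

section \<open>Scalar bounds for linear and quadratic forms\<close>

text \<open>Duality of the sum norm and the uniform norm; it passes the third moment bound from
  \<open>Z\<close> to \<open>t \<bullet> Z\<close>.\<close>

lemma abs_inner_le_infnorm:
  fixes t v :: "real ^ 'p"
  shows "\<bar>t \<bullet> v\<bar> \<le> (\<Sum>a\<in>UNIV. \<bar>t $ a\<bar>) * infnorm v"
proof -
  have "\<bar>t \<bullet> v\<bar> \<le> (\<Sum>a\<in>UNIV. \<bar>t $ a * v $ a\<bar>)"
    unfolding inner_vec_def inner_real_def by (rule sum_abs)
  also have "\<dots> \<le> (\<Sum>a\<in>UNIV. \<bar>t $ a\<bar> * infnorm v)"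
    by (intro sum_mono) (simp add: abs_mult mult_left_mono component_le_infnorm_cart)
  finally show ?thesis by (simp add: sum_distrib_right)
qed

lemma abs_quadratic_form_le:
  fixes t :: "real ^ 'p" and A :: "real ^ 'p ^ 'p"
  shows "\<bar>t \<bullet> (A *v t)\<bar> \<le> (\<Sum>a\<in>UNIV. \<bar>t $ a\<bar>)\<^sup>2 * norm A"
proof -
  have "\<bar>t \<bullet> (A *v t)\<bar> \<le> (\<Sum>a\<in>UNIV. \<bar>t $ a * (A *v t) $ a\<bar>)"
    unfolding inner_vec_def inner_real_def by (rule sum_abs)
  also have "\<dots> \<le> (\<Sum>a\<in>UNIV. \<bar>t $ a\<bar> * (\<Sum>b\<in>UNIV. \<bar>A $ a $ b * t $ b\<bar>))"
    unfolding matrix_vector_mult_def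
    by (intro sum_mono) (simp add: abs_mult[of "t $ _"] mult_left_mono sum_abs)
  also have "\<dots> \<le> (\<Sum>a\<in>UNIV. \<bar>t $ a\<bar> * (\<Sum>b\<in>UNIV. norm A * \<bar>t $ b\<bar>))"
  proof (intro sum_mono mult_left_mono)
    fix a b
    have "\<bar>A $ a $ b\<bar> \<le> norm A"
      using component_le_norm_cart[of "A $ a" b] Finite_Cartesian_Product.norm_nth_le[of A a] by simp
    then show "\<bar>A $ a $ b * t $ b\<bar> \<le> norm A * \<bar>t $ b\<bar>"
      by (simp add: abs_mult mult_right_mono)
  qed auto
  also have "\<dots> = (\<Sum>a\<in>UNIV. \<bar>t $ a\<bar>)\<^sup>2 * norm A"
    by (simp add: power2_eq_square mult_ac flip: sum_distrib_left sum_distrib_right)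
  finally show ?thesis .
qed

text \<open>Turns the matrix average of the covariance hypothesis into the scalar average of
  products required by the one-dimensional estimate.\<close>

lemma quadratic_form_outer: "t \<bullet> (outer v w *v t) = (t \<bullet> v) * (t \<bullet> w)"
proof -
  have "outer v w *v t = (t \<bullet> w) *\<^sub>R v"
    by (simp add: vec_eq_iff outer_def inner_vec_def matrix_vector_mult_def sum_distrib_left mult_ac)
  then show ?thesis by simp
qed

lemma quadratic_form_sum:
  fixes A :: "'i \<Rightarrow> real ^ 'p ^ 'p"
  shows "t \<bullet> ((\<Sum>i\<in>I. A i) *v t) = (\<Sum>i\<in>I. t \<bullet> (A i *v t))"
  by (induction I rule: infinite_finite_induct)
    (simp_all add: matrix_vector_mult_add_rdistrib inner_add_right)

section \<open>Orthogonality from conditional centring\<close>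

context prob_space
begin

text \<open>A bounded \<open>F\<close>-measurable factor can be moved inside the conditional
  expectation; this is done coordinate by coordinate and recombined with the weights
  \<open>t $ l\<close>.\<close>

lemma integral_mult_inner_eq_0:
  fixes Z :: "'a \<Rightarrow> real ^ 'p"
  assumes F: "subalgebra M F"
    and int: "\<And>l. integrable M (\<lambda>\<omega>. Z \<omega> $ l)"
    and centred: "AE \<omega> in M. vec_cond_exp M F Z \<omega> = 0"
    and h: "h \<in> borel_measurable F" "\<And>\<omega>. \<bar>h \<omega> :: real\<bar> \<le> 1"
  shows "(\<integral>\<omega>. h \<omega> * (t \<bullet> Z \<omega>) \<partial>M) = 0"
    and "integrable M (\<lambda>\<omega>. h \<omega> * (t \<bullet> Z \<omega>))"
proof -
  interpret finite_measure_subalgebra M F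
    by (simp add: finite_measure_subalgebra_def finite_measure_subalgebra_axioms_def F finite_measure_axioms)
  have hM: "h \<in> borel_measurable M"
    by (rule measurable_from_subalg[OF F h(1)])
  have i: "integrable M (\<lambda>\<omega>. h \<omega> * Z \<omega> $ l)" for l
    using int[of l] by (rule Bochner_Integration.integrable_bound)
      (use int[of l] hM h(2) in \<open>auto simp: abs_mult intro!: AE_I2 mult_left_le_one_le\<close>)
  have z: "(\<integral>\<omega>. h \<omega> * Z \<omega> $ l \<partial>M) = 0" for l
  proof -
    have "(\<integral>\<omega>. h \<omega> * Z \<omega> $ l \<partial>M) = (\<integral>\<omega>. h \<omega> * real_cond_exp M F (\<lambda>\<omega>. Z \<omega> $ l) \<omega> \<partial>M)"
      using int[of l] by (intro real_cond_exp_intg(2)[symmetric] i h(1)) auto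
    also have "\<dots> = (\<integral>\<omega>. 0 \<partial>M)"
    proof (rule integral_cong_AE)
      show "AE \<omega> in M. h \<omega> * real_cond_exp M F (\<lambda>\<omega>. Z \<omega> $ l) \<omega> = 0"
        using centred by eventually_elim (simp add: vec_cond_exp_def vec_eq_iff)
    qed (use hM in auto)
    finally show ?thesis by simp
  qed
  have "h \<omega> * (t \<bullet> Z \<omega>) = (\<Sum>l\<in>UNIV. t $ l * (h \<omega> * Z \<omega> $ l))" for \<omega>
    by (simp add: inner_vec_def sum_distrib_left mult_ac)
  then show "(\<integral>\<omega>. h \<omega> * (t \<bullet> Z \<omega>) \<partial>M) = 0" "integrable M (\<lambda>\<omega>. h \<omega> * (t \<bullet> Z \<omega>))"
    using i z by (simp_all add: Bochner_Integration.integral_sum)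
qed

text \<open>Euler's formula reduces the complex weight to \<open>cos\<close> and \<open>sin\<close>
  of \<open>U\<close>, both bounded by \<open>1\<close>.\<close>

lemma integral_inner_mult_iexp_eq_0:
  fixes Z :: "'a \<Rightarrow> real ^ 'p"
  assumes F: "subalgebra M F"
    and int: "\<And>l. integrable M (\<lambda>\<omega>. Z \<omega> $ l)"
    and centred: "AE \<omega> in M. vec_cond_exp M F Z \<omega> = 0"
    and U[measurable]: "U \<in> borel_measurable F"
  shows "(CLINT \<omega>|M. (t \<bullet> Z \<omega>) * iexp (U \<omega>)) = 0"
proof -
  note z = integral_mult_inner_eq_0[OF F int centred, of _ t]
  have c: "(\<lambda>\<omega>. cos (U \<omega>)) \<in> borel_measurable F" and s: "(\<lambda>\<omega>. sin (U \<omega>)) \<in> borel_measurable F"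
    by measurable
  have e: "(t \<bullet> Z \<omega>) * iexp (U \<omega>)
      = of_real (cos (U \<omega>) * (t \<bullet> Z \<omega>)) + \<i> * of_real (sin (U \<omega>) * (t \<bullet> Z \<omega>))" for \<omega>
    by (simp add: exp_Euler cos_of_real sin_of_real algebra_simps)
  have "(CLINT \<omega>|M. (t \<bullet> Z \<omega>) * iexp (U \<omega>))
      = (CLINT \<omega>|M. of_real (cos (U \<omega>) * (t \<bullet> Z \<omega>))) + \<i> * (CLINT \<omega>|M. of_real (sin (U \<omega>) * (t \<bullet> Z \<omega>)))"
    unfolding e using z(2)[OF c] z(2)[OF s]
    by (subst Bochner_Integration.integral_add)
       (simp_all del: of_real_mult add: complex_of_real_integrable_eq)
  then show ?thesis
    using z(1)[OF c] z(1)[OF s] by (simp del: of_real_mult)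
qed

end

text \<open>The estimate for locally dependent sums applied to \<open>t \<bullet> Z k\<close>. Its
  orthogonality condition holds because a sum over sites that are not neighbours of \<open>k\<close>
  never reads \<open>X k\<close>.\<close>

lemma (in prob_space) expectation_iexp_local_field:
  fixes X :: "int ^ 'd \<Rightarrow> 'a \<Rightarrow> 's" and Z :: "int ^ 'd \<Rightarrow> 'a \<Rightarrow> real ^ 'p" and t :: "real ^ 'p"
  assumes X: "\<And>i. X i \<in> M \<rightarrow>\<^sub>M S"
    and K: "finite K" "K \<noteq> {}"
    and f: "\<And>k. k \<in> K \<Longrightarrow> f k \<in> (\<Pi>\<^sub>M i\<in>I0. S) \<rightarrow>\<^sub>M borel"
    and Z: "\<And>k \<omega>. k \<in> K \<Longrightarrow> Z k \<omega> = f k (\<lambda>i\<in>I0. X (k + i) \<omega>)"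
    and moment: "\<And>k. k \<in> K \<Longrightarrow> (\<integral>\<^sup>+ \<omega>. ennreal (infnorm (Z k \<omega>) ^ 3) \<partial>M) \<le> ennreal C" "0 \<le> C"
    and centred: "\<And>k. k \<in> K \<Longrightarrow>
      AE \<omega> in M. vec_cond_exp M (sigma_gen_vars M S (- {k}) X) (Z k) \<omega> = 0"
    and v: "0 \<le> v"
  shows "cmod ((CLINT \<omega>|M. iexp ((\<Sum>k\<in>K. t \<bullet> Z k \<omega>) / sqrt (card K))) - of_real (exp (- v / 2)))
    \<le> expectation (\<lambda>\<omega>. \<bar>(\<Sum>k\<in>K. \<Sum>j\<in>{j \<in> K. unorm (j - k) \<le> 1}. (t \<bullet> Z k \<omega>) * (t \<bullet> Z j \<omega>)) / card K - v\<bar>)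
      + 3 / 2 * (real (card (I0 :: (int ^ 'd) set)))\<^sup>2 * ((\<Sum>a\<in>UNIV. \<bar>t $ a\<bar>) ^ 3 * C) / sqrt (card K)"
proof (rule expectation_iexp_local_dependence[where Y="\<lambda>k \<omega>. t \<bullet> Z k \<omega>"
    and nb="\<lambda>k. {j \<in> K. unorm (j - k) \<le> 1}", OF K _ _ _ _ _ _ v])
  have meas: "Z k \<in> borel_measurable N" if "k \<in> K" "\<And>i. i \<in> I0 \<Longrightarrow> X (k + i) \<in> N \<rightarrow>\<^sub>M S" for k N
  proof -
    have "(\<lambda>\<omega>. f k (\<lambda>i\<in>I0. X (k + i) \<omega>)) \<in> borel_measurable N"
      by (rule measurable_local_function[OF f[OF that(1)]]) (rule that(2))
    then show ?thesis by (simp only: Z[OF that(1), symmetric])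
  qed
  have mZ[measurable]: "Z k \<in> borel_measurable M" if "k \<in> K" for k
    by (rule meas[OF that X])
  have [measurable]: "(infnorm :: real ^ 'p \<Rightarrow> real) \<in> borel_measurable borel"
    by (intro borel_measurable_continuous_onI continuous_on_infnorm continuous_on_id)
  have iZ: "integrable M (\<lambda>\<omega>. infnorm (Z k \<omega>) ^ 3)"
    and eZ: "expectation (\<lambda>\<omega>. infnorm (Z k \<omega>) ^ 3) \<le> C" if k: "k \<in> K" for k
  proof -
    note [measurable] = mZ[OF k]
    have "(\<integral>\<^sup>+ \<omega>. ennreal (infnorm (Z k \<omega>) ^ 3) \<partial>M) < \<infinity>"
      using le_less_trans[OF moment(1)[OF k] ennreal_less_top] by simp
    then show i: "integrable M (\<lambda>\<omega>. infnorm (Z k \<omega>) ^ 3)"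
      by (intro integrableI_nonneg) (auto simp: infnorm_pos_le)
    have "ennreal (expectation (\<lambda>\<omega>. infnorm (Z k \<omega>) ^ 3)) \<le> ennreal C"
      using moment(1)[OF k] by (subst nn_integral_eq_integral[OF i, symmetric]) (auto simp: infnorm_pos_le)
    then show "expectation (\<lambda>\<omega>. infnorm (Z k \<omega>) ^ 3) \<le> C"
      using moment(2) by (simp add: ennreal_le_iff)
  qed
  have iZl: "integrable M (\<lambda>\<omega>. Z k \<omega> $ l)" if k: "k \<in> K" for k l
  proof -
    note [measurable] = measurable_compose[OF mZ[OF k] borel_measurable_nth]
    have s: "integrable M (\<lambda>\<omega>. infnorm (Z k \<omega>) ^ 3 + 2)" using iZ[OF k] by simp
    \<comment> \<open>The constant \<open>2\<close> comes from the two unit factors in the triple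
      product bound.\<close>
    have "\<bar>Z k \<omega> $ l\<bar> \<le> infnorm (Z k \<omega>) ^ 3 + 2" for \<omega>
      using abs_triple_product_le[of "infnorm (Z k \<omega>)" 1 1] component_le_infnorm_cart[of "Z k \<omega>" l]
      by (simp add: infnorm_pos_le)
    then show ?thesis
      by (intro Bochner_Integration.integrable_bound[OF s]) (auto intro!: AE_I2 order_trans[OF _ abs_ge_self])
  qed
  let ?T = "\<Sum>a\<in>UNIV. \<bar>t $ a\<bar>"
  have T0: "0 \<le> ?T" by (intro sum_nonneg) simp
  have Yle: "\<bar>t \<bullet> Z k \<omega>\<bar> ^ 3 \<le> ?T ^ 3 * infnorm (Z k \<omega>) ^ 3" for k \<omega>
    unfolding power_mult_distrib[symmetric] by (intro power_mono abs_inner_le_infnorm) simp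
  show mY: "(\<lambda>\<omega>. t \<bullet> Z k \<omega>) \<in> borel_measurable M" if "k \<in> K" for k
    using mZ[OF that] by measurable
  show i: "integrable M (\<lambda>\<omega>. \<bar>t \<bullet> Z k \<omega>\<bar> ^ 3)" if k: "k \<in> K" for k
    by (rule Bochner_Integration.integrable_bound[OF integrable_mult_right[OF iZ[OF k], of "?T ^ 3"]])
      (use mY[OF k] in \<open>auto intro!: AE_I2 order_trans[OF Yle]\<close>)
  show "expectation (\<lambda>\<omega>. \<bar>t \<bullet> Z k \<omega>\<bar> ^ 3) \<le> ?T ^ 3 * C" if k: "k \<in> K" for k
  proof -
    have "expectation (\<lambda>\<omega>. \<bar>t \<bullet> Z k \<omega>\<bar> ^ 3) \<le> expectation (\<lambda>\<omega>. ?T ^ 3 * infnorm (Z k \<omega>) ^ 3)"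
      using iZ[OF k] by (intro integral_mono i k Yle) auto
    also have "\<dots> \<le> ?T ^ 3 * C"
      using eZ[OF k] T0 by (simp add: mult_left_mono)
    finally show ?thesis .
  qed
  show "{j \<in> K. unorm (j - k) \<le> 1} \<subseteq> K" for k by auto
  show "card {j \<in> K. unorm (j - k) \<le> 1} \<le> card (I0 :: (int ^ 'd) set)" for k
    by (rule card_neighbours_le)
  show "(CLINT \<omega>|M. (t \<bullet> Z k \<omega>) * iexp (s * (\<Sum>j\<in>K - {j \<in> K. unorm (j - k) \<le> 1}. t \<bullet> Z j \<omega>))) = 0"
    if k: "k \<in> K" for k s
  proof (rule integral_inner_mult_iexp_eq_0[OF subalgebra_sigma_gen_vars iZl[OF k] centred[OF k]])
    let ?F = "sigma_gen_vars M S (- {k}) X"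
    have "Z j \<in> borel_measurable ?F" if j: "j \<in> K - {j \<in> K. unorm (j - k) \<le> 1}" for j
    proof (rule meas)
      fix i :: "int ^ 'd" assume i: "i \<in> I0"
      \<comment> \<open>Symmetry of \<open>I0\<close> under \<open>i \<mapsto> - i\<close>: a window
        around \<open>j\<close> that contains \<open>k\<close> makes \<open>j\<close> a neighbour of
        \<open>k\<close>.\<close>
      have "j + i \<noteq> k"
      proof
        assume "j + i = k"
        then have "j - k = - i" by (simp add: algebra_simps)
        with i have "unorm (j - k) \<le> 1" by (simp add: I0_def unorm_le_iff)
        with j show False by simp
      qed
      then show "X (j + i) \<in> ?F \<rightarrow>\<^sub>M S" by (intro measurable_sigma_gen_vars X) simp
    qed (use j in simp)
    then show "(\<lambda>\<omega>. s * (\<Sum>j\<in>K - {j \<in> K. unorm (j - k) \<le> 1}. t \<bullet> Z j \<omega>)) \<in> borel_measurable ?F"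
      by (intro borel_measurable_times borel_measurable_const borel_measurable_sum borel_measurable_inner)
  qed (rule X)
qed

section \<open>The normal law and the central limit theorem\<close>

lemma prob_space_mv_normal: "prob_space (mv_normal m V)"
proof -
  have N: "prob_space std_normal_distribution"
    using real_dist_normal_dist by (simp add: real_distribution_def)
  interpret product_prob_space "\<lambda>_. std_normal_distribution" UNIV
    by (simp add: product_prob_space_def product_prob_space_axioms_def product_sigma_finite_def
        N prob_space_imp_sigma_finite)
  have "(\<lambda>z. m + A *v (\<chi> a. z a)) \<in> (\<Pi>\<^sub>M a\<in>UNIV. std_normal_distribution) \<rightarrow>\<^sub>M borel" for A :: "real ^ 'a ^ 'a"
  proof -
    have c: "(\<lambda>z :: 'a \<Rightarrow> real. z a) \<in> (\<Pi>\<^sub>M a\<in>UNIV. std_normal_distribution) \<rightarrow>\<^sub>M borel" for a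
      using measurable_component_singleton[of a UNIV "\<lambda>_. std_normal_distribution"] by simp
    have "(\<lambda>z. m + (\<Sum>a\<in>UNIV. z a *\<^sub>R column a A)) \<in> (\<Pi>\<^sub>M a\<in>UNIV. std_normal_distribution) \<rightarrow>\<^sub>M borel"
      using c by (intro borel_measurable_add borel_measurable_sum borel_measurable_scaleR) auto
    then show ?thesis
      by (simp add: matrix_mult_sum scalar_mult_eq_scaleR)
  qed
  then show ?thesis
    unfolding mv_normal_def Let_def
    by (intro prob_space.prob_space_distr prob_space_PiM N)
qed

text \<open>Each row has its own probability space \<open>M n\<close>. The moment and covariance
  hypotheses use integrals with values in \<open>[0, \<infinity>]\<close>, so that finiteness is
  asserted and not hidden in a default value.\<close>

theorem theorem21:
  fixes M :: "nat \<Rightarrow> 'w measure"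
    and S :: "'s measure"
    and X :: "nat \<Rightarrow> int ^ 'd \<Rightarrow> 'w \<Rightarrow> 's"
    and K :: "nat \<Rightarrow> (int ^ 'd) set"
    and f :: "nat \<Rightarrow> int ^ 'd \<Rightarrow> (int ^ 'd \<Rightarrow> 's) \<Rightarrow> real ^ 'p"
    and Z :: "nat \<Rightarrow> int ^ 'd \<Rightarrow> 'w \<Rightarrow> real ^ 'p"
    and \<Sigma> :: "real ^ 'p ^ 'p"
  assumes prob: "\<And>n. prob_space (M n)"
    and X: "\<And>n i. X n i \<in> M n \<rightarrow>\<^sub>M S"
    and K: "\<And>n. finite (K n)"
    and f: "\<And>n k. k \<in> K n \<Longrightarrow> f n k \<in> (\<Pi>\<^sub>M i\<in>I0. S) \<rightarrow>\<^sub>M borel"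
    and Z: "\<And>n k \<omega>. k \<in> K n \<Longrightarrow> Z n k \<omega> = f n k (\<lambda>i\<in>I0. X n (k + i) \<omega>)"
    and moment: "(SUP n. SUP k\<in>K n. \<integral>\<^sup>+ \<omega>. ennreal (infnorm (Z n k \<omega>) ^ 3) \<partial>M n) < \<infinity>"
    and centred: "\<And>n k. k \<in> K n \<Longrightarrow>
      AE \<omega> in M n. vec_cond_exp (M n) (sigma_gen_vars (M n) S (- {k}) (X n)) (Z n k) \<omega> = 0"
    and card: "filterlim (\<lambda>n. card (K n)) at_top sequentially"
    and psd: "psd_matrix \<Sigma>"
    and cov: "(\<lambda>n. \<integral>\<^sup>+ \<omega>. ennreal (norm
        ((1 / real (card (K n))) *\<^sub>R
           (\<Sum>k\<in>K n. \<Sum>j\<in>{j \<in> K n. unorm (j - k) \<le> 1}. outer (Z n k \<omega>) (Z n j \<omega>)) - \<Sigma>)) \<partial>M n)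
      \<longlonglongrightarrow> 0"
  shows "weak_conv_measure
    (\<lambda>n. distr (M n) borel
       (\<lambda>\<omega>. (real (card (K n)) powr (- 1 / 2)) *\<^sub>R (\<Sum>k\<in>K n. Z n k \<omega>)))
    (mv_normal 0 \<Sigma>)"
proof (rule levy_continuity_euclidean)
  have mZ[measurable]: "Z n k \<in> borel_measurable (M n)" if "k \<in> K n" for n k
    using measurable_local_function[OF f[OF that] X] Z[OF that] by (simp cong: measurable_cong)
  have mS: "(\<lambda>\<omega>. (real (card (K n)) powr (- 1 / 2)) *\<^sub>R (\<Sum>k\<in>K n. Z n k \<omega>)) \<in> M n \<rightarrow>\<^sub>M borel" for n
    by measurable
  show "prob_space (distr (M n) borel
      (\<lambda>\<omega>. (real (card (K n)) powr (- 1 / 2)) *\<^sub>R (\<Sum>k\<in>K n. Z n k \<omega>)))" for n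
    by (rule prob_space.prob_space_distr[OF prob mS])
  show "prob_space (mv_normal 0 \<Sigma>)" by (rule prob_space_mv_normal)
  show "sets (mv_normal 0 \<Sigma>) = sets borel" by (simp add: mv_normal_def Let_def)
  obtain C where C: "0 \<le> C"
    and C3: "\<And>n k. k \<in> K n \<Longrightarrow> (\<integral>\<^sup>+ \<omega>. ennreal (infnorm (Z n k \<omega>) ^ 3) \<partial>M n) \<le> ennreal C"
  proof -
    let ?c = "SUP n. SUP k\<in>K n. \<integral>\<^sup>+ \<omega>. ennreal (infnorm (Z n k \<omega>) ^ 3) \<partial>M n"
    have "(\<integral>\<^sup>+ \<omega>. ennreal (infnorm (Z n k \<omega>) ^ 3) \<partial>M n) \<le> ?c" if "k \<in> K n" for n k
      by (rule SUP_upper2[of n], simp, rule SUP_upper[OF that])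
    moreover have "?c = ennreal (enn2real ?c)" using moment by simp
    ultimately show ?thesis using that[of "enn2real ?c"] by simp
  qed
  fix t :: "real ^ 'p"
  let ?P = "\<lambda>n. distr (M n) borel
       (\<lambda>\<omega>. (real (card (K n)) powr (- 1 / 2)) *\<^sub>R (\<Sum>k\<in>K n. Z n k \<omega>))"
  define T where "T = (\<Sum>a\<in>UNIV. \<bar>t $ a\<bar>)"
  define v where "v = t \<bullet> (\<Sigma> *v t)"
  have v: "0 \<le> v" using psd by (simp add: v_def psd_matrix_def)
  define V where "V n \<omega> = (\<Sum>k\<in>K n. \<Sum>j\<in>{j \<in> K n. unorm (j - k) \<le> 1}. (t \<bullet> Z n k \<omega>) * (t \<bullet> Z n j \<omega>))
      / card (K n)" for n \<omega>
  define c where "c = 3 / 2 * (real (card (I0 :: (int ^ 'd) set)))\<^sup>2 * (T ^ 3 * C)"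
  have char_P: "(CLINT x|?P n. iexp (t \<bullet> x))
      = (CLINT \<omega>|M n. iexp ((\<Sum>k\<in>K n. t \<bullet> Z n k \<omega>) / sqrt (card (K n))))" for n
  proof -
    have "(CLINT x|?P n. iexp (t \<bullet> x))
        = (CLINT \<omega>|M n. iexp (t \<bullet> ((real (card (K n)) powr (- 1 / 2)) *\<^sub>R (\<Sum>k\<in>K n. Z n k \<omega>))))"
      by (rule integral_distr[OF mS]) (intro borel_measurable_continuous_onI continuous_intros)
    \<comment> \<open>Also true for empty \<open>K n\<close>, where \<open>0 powr a = 0\<close> and
      division by zero gives \<open>0\<close>.\<close>
    also have "\<dots> = (CLINT \<omega>|M n. iexp ((\<Sum>k\<in>K n. t \<bullet> Z n k \<omega>) / sqrt (card (K n))))"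
      by (simp add: powr_minus_divide powr_half_sqrt inner_sum_right)
    finally show ?thesis .
  qed
  have Vlim: "(\<lambda>n. \<integral>\<omega>. \<bar>V n \<omega> - v\<bar> \<partial>M n) \<longlonglongrightarrow> 0"
  proof -
    let ?A = "\<lambda>n \<omega>. (1 / real (card (K n))) *\<^sub>R
      (\<Sum>k\<in>K n. \<Sum>j\<in>{j \<in> K n. unorm (j - k) \<le> 1}. outer (Z n k \<omega>) (Z n j \<omega>)) - \<Sigma>"
    have VA: "V n \<omega> - v = t \<bullet> (?A n \<omega> *v t)" for n \<omega>
      by (simp add: V_def v_def matrix_vector_mult_diff_rdistrib inner_diff_right quadratic_form_sum
          quadratic_form_outer scaleR_matrix_vector_assoc[symmetric])
    have [measurable]: "V n \<in> borel_measurable (M n)" for n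
      unfolding V_def by measurable
    have [measurable]: "(\<lambda>\<omega>. outer (Z n k \<omega>) (Z n j \<omega>)) \<in> borel_measurable (M n)"
      if "k \<in> K n" "j \<in> K n" for n k j
      by (rule borel_measurable_continuous_Pair[OF mZ[OF that(1)] mZ[OF that(2)]])
        (unfold outer_def, intro continuous_intros)
    \<comment> \<open>The comparison is made between nonnegative integrals, before integrability of
      \<open>V n\<close> is known; \<open>enn2real\<close> then translates the limit to Bochner
      integrals.\<close>
    have bound: "(\<integral>\<^sup>+ \<omega>. ennreal \<bar>V n \<omega> - v\<bar> \<partial>M n)
        \<le> ennreal (T\<^sup>2) * (\<integral>\<^sup>+ \<omega>. ennreal (norm (?A n \<omega>)) \<partial>M n)" for n
    proof -
      have "(\<integral>\<^sup>+ \<omega>. ennreal \<bar>V n \<omega> - v\<bar> \<partial>M n) \<le> (\<integral>\<^sup>+ \<omega>. ennreal (T\<^sup>2) * ennreal (norm (?A n \<omega>)) \<partial>M n)"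
        using abs_quadratic_form_le[of t]
        by (intro nn_integral_mono) (simp add: VA T_def flip: ennreal_mult')
      also have "\<dots> = ennreal (T\<^sup>2) * (\<integral>\<^sup>+ \<omega>. ennreal (norm (?A n \<omega>)) \<partial>M n)"
        by (rule nn_integral_cmult) measurable
      finally show ?thesis .
    qed
    have "(\<lambda>n. ennreal (T\<^sup>2) * (\<integral>\<^sup>+ \<omega>. ennreal (norm (?A n \<omega>)) \<partial>M n)) \<longlonglongrightarrow> ennreal (T\<^sup>2) * 0"
      by (intro ennreal_tendsto_cmult cov) simp
    then have "(\<lambda>n. ennreal (T\<^sup>2) * (\<integral>\<^sup>+ \<omega>. ennreal (norm (?A n \<omega>)) \<partial>M n)) \<longlonglongrightarrow> 0" by simp
    from tendsto_sandwich[OF _ _ tendsto_const this]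
    have "(\<lambda>n. \<integral>\<^sup>+ \<omega>. ennreal \<bar>V n \<omega> - v\<bar> \<partial>M n) \<longlonglongrightarrow> ennreal 0"
      using bound by simp
    from tendsto_enn2real[OF this] show ?thesis
      by (simp add: integral_eq_nn_integral)
  qed
  have "(\<lambda>n. (\<integral>\<omega>. \<bar>V n \<omega> - v\<bar> \<partial>M n) + c / sqrt (card (K n))) \<longlonglongrightarrow> 0 + 0"
    using filterlim_compose[OF filterlim_real_sequentially card]
    by (intro tendsto_add Vlim tendsto_divide_0[OF tendsto_const]
        filterlim_at_top_imp_at_infinity filterlim_compose[OF sqrt_at_top])
  moreover have "\<forall>\<^sub>F n in sequentially. cmod ((CLINT x|?P n. iexp (t \<bullet> x)) - of_real (exp (- v / 2)))
      \<le> (\<integral>\<omega>. \<bar>V n \<omega> - v\<bar> \<partial>M n) + c / sqrt (card (K n))"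
  proof -
    \<comment> \<open>Finitely many rows may be empty, and the estimate is for nonempty
      ones.\<close>
    have "\<forall>\<^sub>F n in sequentially. 1 \<le> card (K n)"
      using card by (simp add: filterlim_at_top)
    then show ?thesis
    proof eventually_elim
      case (elim n)
      then have "K n \<noteq> {}" by auto
      from prob_space.expectation_iexp_local_field[OF prob X K this f Z C3 C centred v, of n t]
      show ?case unfolding char_P V_def c_def T_def by simp
    qed
  qed
  ultimately have "(\<lambda>n. (CLINT x|?P n. iexp (t \<bullet> x)) - of_real (exp (- v / 2))) \<longlonglongrightarrow> 0"
    by (simp only: add_0) (rule Lim_null_comparison)
  then have "(\<lambda>n. CLINT x|?P n. iexp (t \<bullet> x)) \<longlonglongrightarrow> of_real (exp (- v / 2))"
    by (simp only: LIM_zero_iff)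
  also have "complex_of_real (exp (- v / 2)) = (CLINT x|mv_normal 0 \<Sigma>. iexp (t \<bullet> x))"
    by (simp add: char_mv_normal[OF psd] v_def)
  finally show "(\<lambda>n. CLINT x|?P n. iexp (t \<bullet> x)) \<longlonglongrightarrow> (CLINT x|mv_normal 0 \<Sigma>. iexp (t \<bullet> x))" .
qed simp

end
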